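(* Let $A\in\mathrm{GL}(2d,\mathbb{R})$ and assume that $\mathcal{B}_A$ belongs to the Cohen's class. For any $f,g\in\mathcal{S}(\mathbb{R}^d)$ the following properties hold. (i) (Correct marginal densities) $\int_{\mathbb{R}^d}\mathcal{B}_Af(x,\omega)\,d\omega=|f(x)|^2$ and $\int_{\mathbb{R}^d}\mathcal{B}_Af(x,\omega)\,dx=|\hat f(\omega)|^2$ for all $x,\omega\in\mathbb{R}^d$. In particular, $\iint_{\mathbb{R}^{2d}}\mathcal{B}_Af(x,\omega)\,dx\,d\omega=\|f\|_{L^2}^2$. (ii) (Moyal's identity) $\langle\mathcal{B}_Af,\mathcal{B}_Ag\rangle_{L^2(\mathbb{R}^{2d})}=|\langle f,g\rangle|^2$. (iii) (Symmetry) For all $x,\omega\in\mathbb{R}^d$, $\mathcal{B}_A(\mathcal{I}f)(x,\omega)=\mathcal{B}_Af(-x,-\omega)$, where $\mathcal{I}f(t)=f(-t)$, and $\mathcal{B}_A(\overline f)(x,\omega)=\overline{\mathcal{B}_Af(x,-\omega)}$. (iv) (Convolution properties) For all $x,\omega\in\mathbb{R}^d$, $$\mathcal{B}_A(f*g)(x,\omega)=\big(\mathcal{B}_Af(\cdot,\omega)*\mathcal{B}_Ag(\cdot,\omega)\big)(x),\qquad \mathcal{B}_A(f\cdot g)(x,\omega)=\big(\mathcal{B}_Af(x,\cdot)*\mathcal{B}_Ag(x,\cdot)\big)(\omega).$$ (v) (Scaling invariance) Setting $U_\lambda f(t)=|\lambda|^{d/2}f(\lambda t)$ for $\lambda\in\mathbb{R}\setminus\{0\}$,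 $t\in\mathbb{R}^d$, one has $\mathcal{B}_A(U_\lambda f)(x,\omega)=\mathcal{B}_Af(\lambda x,\lambda^{-1}\omega)$ for all $x,\omega\in\mathbb{R}^d$.
   Context: For $A\in\mathrm{GL}(2d,\mathbb{R})$ with $d\times d$ blocks $A_{ij}$, $$\mathcal{B}_A(f,g)(x,\omega)=\int_{\mathbb{R}^d}e^{-2\pi i\omega\cdot y}f(A_{11}x+A_{12}y)\overline{g(A_{21}x+A_{22}y)}\,dy,\qquad \mathcal{B}_Af=\mathcal{B}_A(f,f).$$ $\mathcal{B}_A$ belongs to the Cohen's class if there exists $\theta\in\mathcal{S}'(\mathbb{R}^{2d})$ such that $\mathcal{B}_A(f,g)=W(f,g)*\theta$ for all $f,g\in\mathcal{S}(\mathbb{R}^d)$, where $W(f,g)(x,\omega)=\int_{\mathbb{R}^d}e^{-2\pi iy\cdot\omega}f(x+\tfrac12y)\overline{g(x-\tfrac12y)}\,dy$. The Fourier transform is $\hat f(\omega)=\int_{\mathbb{R}^d}e^{-2\pi ix\cdot\omega}f(x)\,dx$; $\langle f,g\rangle=\int f\overline g$. *)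

theory Defs
  imports "HOL-Analysis.Analysis"
begin

section \<open>Schwartz functions and tempered distributions\<close>

primrec iter_partial :: "'a::euclidean_space list \<Rightarrow> ('a \<Rightarrow> complex) \<Rightarrow> 'a \<Rightarrow> complex" where
  "iter_partial [] f = f"
| "iter_partial (b # bs) f = (\<lambda>x. frechet_derivative (iter_partial bs f) (at x) b)"

text \<open>
  Partial derivatives are indexed by lists of basis vectors rather than by multi-indices: a list in
  which every basis vector \<open>b\<close> occurs \<open>\<beta> b\<close> times stands for the multi-index \<open>\<beta>\<close>. Since all
  iterated partial derivatives are required to be differentiable everywhere, a Schwartz function is
  \<open>C\<^sup>\<infinity>\<close>, and the order of the vectors in the list is irrelevant.
\<close>

definition schwartz :: "('a::euclidean_space \<Rightarrow> complex) \<Rightarrow> bool" where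
  "schwartz f \<longleftrightarrow>
     (\<forall>bs. set bs \<subseteq> Basis \<longrightarrow>
        (\<forall>x. iter_partial bs f differentiable (at x)) \<and>
        (\<forall>k::nat. bounded (range (\<lambda>x. (1 + norm x) ^ k *\<^sub>R iter_partial bs f x))))"

definition schwartz_seminorm :: "nat \<Rightarrow> 'a::euclidean_space list \<Rightarrow> ('a \<Rightarrow> complex) \<Rightarrow> real" where
  "schwartz_seminorm k bs f = (SUP x. (1 + norm x) ^ k * norm (iter_partial bs f x))"

text \<open>
  A distribution is represented by a function on all of \<open>'a \<Rightarrow> complex\<close>, of which only the values
  on Schwartz functions matter. The last conjunct is continuity of the linear functional for the
  topology generated by the Schwartz seminorms (which increase in \<open>k\<close>).
\<close>

definition tempered_distribution :: "(('a::euclidean_space \<Rightarrow> complex) \<Rightarrow> complex) \<Rightarrow> bool" where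
  "tempered_distribution \<theta> \<longleftrightarrow>
     (\<forall>\<phi> \<psi>. schwartz \<phi> \<longrightarrow> schwartz \<psi> \<longrightarrow> \<theta> (\<lambda>x. \<phi> x + \<psi> x) = \<theta> \<phi> + \<theta> \<psi>) \<and>
     (\<forall>c \<phi>. schwartz \<phi> \<longrightarrow> \<theta> (\<lambda>x. c * \<phi> x) = c * \<theta> \<phi>) \<and>
     (\<exists>C N. \<forall>\<phi>. schwartz \<phi> \<longrightarrow>
        norm (\<theta> \<phi>) \<le> C * (\<Sum>bs | set bs \<subseteq> Basis \<and> length bs \<le> N. schwartz_seminorm N bs \<phi>))"

definition distr_conv ::
    "('a::euclidean_space \<Rightarrow> complex) \<Rightarrow> (('a \<Rightarrow> complex) \<Rightarrow> complex) \<Rightarrow> 'a \<Rightarrow> complex" where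
  "distr_conv \<Phi> \<theta> z = \<theta> (\<lambda>w. \<Phi> (z - w))"

section \<open>Functions on Euclidean space\<close>

definition fourier :: "('a::euclidean_space \<Rightarrow> complex) \<Rightarrow> 'a \<Rightarrow> complex" where
  "fourier f \<omega> = (\<integral>x. exp (- 2 * pi * \<i> * (x \<bullet> \<omega>)) * f x \<partial>lborel)"

definition conv :: "('a::euclidean_space \<Rightarrow> complex) \<Rightarrow> ('a \<Rightarrow> complex) \<Rightarrow> 'a \<Rightarrow> complex" where
  "conv f g x = (\<integral>t. f t * g (x - t) \<partial>lborel)"

definition L2_inner :: "('a::euclidean_space \<Rightarrow> complex) \<Rightarrow> ('a \<Rightarrow> complex) \<Rightarrow> complex" where
  "L2_inner f g = (\<integral>x. f x * cnj (g x) \<partial>lborel)"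

definition L2_norm :: "('a::euclidean_space \<Rightarrow> complex) \<Rightarrow> real" where
  "L2_norm f = sqrt (\<integral>x. (norm (f x))\<^sup>2 \<partial>lborel)"

definition reflect :: "('a::euclidean_space \<Rightarrow> complex) \<Rightarrow> 'a \<Rightarrow> complex" where
  "reflect f t = f (- t)"

definition dilate :: "real \<Rightarrow> ('a::euclidean_space \<Rightarrow> complex) \<Rightarrow> 'a \<Rightarrow> complex" where
  "dilate r f t = (\<bar>r\<bar> powr (DIM('a) / 2)) *\<^sub>R f (r *\<^sub>R t)"

section \<open>Matrix-Wigner distributions and the Cohen class\<close>

text \<open>
  The index type \<open>'d + 'd\<close> gives the \<open>2d \<times> 2d\<close> matrices together with their blocks; phase space
  \<open>\<real>\<^sup>2\<^sup>d\<close> is the type of pairs \<open>(x, \<omega>)\<close>.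
\<close>

definition block11 :: "real^('d::finite + 'd)^('d + 'd) \<Rightarrow> real^'d^'d" where
  "block11 A = (\<chi> i j. A $ Inl i $ Inl j)"

definition block12 :: "real^('d::finite + 'd)^('d + 'd) \<Rightarrow> real^'d^'d" where
  "block12 A = (\<chi> i j. A $ Inl i $ Inr j)"

definition block21 :: "real^('d::finite + 'd)^('d + 'd) \<Rightarrow> real^'d^'d" where
  "block21 A = (\<chi> i j. A $ Inr i $ Inl j)"

definition block22 :: "real^('d::finite + 'd)^('d + 'd) \<Rightarrow> real^'d^'d" where
  "block22 A = (\<chi> i j. A $ Inr i $ Inr j)"

definition mat_wigner ::
    "real^('d::finite + 'd)^('d + 'd) \<Rightarrow> (real^'d \<Rightarrow> complex) \<Rightarrow> (real^'d \<Rightarrow> complex)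
       \<Rightarrow> (real^'d) \<times> (real^'d) \<Rightarrow> complex" where
  "mat_wigner A f g = (\<lambda>(x, \<omega>).
     \<integral>y. exp (- 2 * pi * \<i> * (\<omega> \<bullet> y)) * f (block11 A *v x + block12 A *v y)
           * cnj (g (block21 A *v x + block22 A *v y)) \<partial>lborel)"

definition wigner ::
    "(real^'d::finite \<Rightarrow> complex) \<Rightarrow> (real^'d \<Rightarrow> complex) \<Rightarrow> (real^'d) \<times> (real^'d) \<Rightarrow> complex" where
  "wigner f g = (\<lambda>(x, \<omega>).
     \<integral>y. exp (- 2 * pi * \<i> * (y \<bullet> \<omega>)) * f (x + (1/2) *\<^sub>R y)
           * cnj (g (x - (1/2) *\<^sub>R y)) \<partial>lborel)"

definition in_Cohen_class :: "real^('d::finite + 'd)^('d + 'd) \<Rightarrow> bool" where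
  "in_Cohen_class A \<longleftrightarrow>
     (\<exists>\<theta>. tempered_distribution \<theta> \<and>
        (\<forall>f g. schwartz f \<longrightarrow> schwartz g \<longrightarrow> mat_wigner A f g = distr_conv (wigner f g) \<theta>))"

abbreviation mat_wigner_quad ::
    "real^('d::finite + 'd)^('d + 'd) \<Rightarrow> (real^'d \<Rightarrow> complex) \<Rightarrow> (real^'d) \<times> (real^'d) \<Rightarrow> complex" where
  "mat_wigner_quad A f \<equiv> mat_wigner A f f"

end

theory Submission
  imports Defs "HOL-Probability.Characteristic_Functions" "HOL-Probability.Sinc_Integral"
begin

text \<open>
Convolution with a fixed \<open>\<theta>\<close> commutes with translations of phase space, and the Wigner distribution
turns a translation or a modulation of both arguments into such a translation. Hence a matrix-Wigner
distribution of Cohen's class is covariant: shifting \<open>f\<close> and \<open>g\<close> in time or in frequency shifts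
\<open>\<B>\<^sub>A(f,g)\<close> by the same amount. Both sides of the covariance identities are Fourier transforms in
\<open>\<omega>\<close> of explicit products, so for Gaussian \<open>f = g\<close> injectivity of the Fourier transform
(\<open>fourier_injective\<close>) turns them into pointwise identities between Gaussians and exponentials.
These force \<open>A\<^sub>1\<^sub>1 = A\<^sub>2\<^sub>1 = I\<close> and \<open>A\<^sub>2\<^sub>2 = A\<^sub>1\<^sub>2 - I\<close> (\<open>Cohen_class_blocks\<close>).

With \<open>T = A\<^sub>1\<^sub>2\<close> this says that \<open>\<B>\<^sub>A(f,g)(x,\<cdot>)\<close> is the Fourier transform of
\<open>y \<mapsto> f(x + T y) cnj (g(x + T y - y))\<close>. The map \<open>(x,y) \<mapsto> (x + T y, x + T y - y)\<close> is a composition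
of two shears and a reflection and so preserves Lebesgue measure (\<open>distr_lborel_shear\<close>). The
properties then split into three kinds.

\<^item> Symmetry and scaling are substitutions in the integral over \<open>y\<close>.
\<^item> The marginal in \<open>\<omega>\<close>, Moyal's identity and the product formula undo the Fourier transform in
  \<open>y\<close>: they are Fourier inversion, its consequence \<open>parseval\<close>, and the convolution theorem
  \<open>conv_fourier\<close>.
\<^item> The marginal in \<open>x\<close>, the second half of Moyal's identity and the convolution formula change
  variables from \<open>(x,y)\<close> to the two arguments of \<open>f\<close> and \<open>cnj g\<close>, where the integrand is a tensor
  product.

The distribution is absolutely integrable, both in each variable and on phase space, because it is
rapidly decreasing in \<open>x\<close> and \<open>\<omega>\<close> jointly (\<open>tau_wigner_decay\<close>). Decay in \<open>x\<close> is read off the integrand. Decay in \<open>\<omega>\<close> comes from integration by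
parts: multiplying by a coordinate of \<open>\<omega>\<close> expresses the distribution of \<open>(f,g)\<close> through
distributions of pairs in which one function is differentiated (\<open>tau_wigner_derivative_rule\<close>);
these are again pairs of Schwartz functions, so the argument iterates.
\<close>

section \<open>Schwartz functions\<close>

definition rapidly_decreasing :: "('a::euclidean_space \<Rightarrow> complex) \<Rightarrow> bool" where
  "rapidly_decreasing h \<longleftrightarrow> (\<forall>k::nat. \<exists>C. \<forall>x. (1 + norm x) ^ k * norm (h x) \<le> C)"

lemma rapidly_decreasing_add:
  assumes "rapidly_decreasing f" "rapidly_decreasing g"
  shows "rapidly_decreasing (\<lambda>x. f x + g x)"
  unfolding rapidly_decreasing_def
proof
  fix k :: nat
  obtain C D where C: "\<And>x. (1 + norm x) ^ k * norm (f x) \<le> C"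
    and D: "\<And>x. (1 + norm x) ^ k * norm (g x) \<le> D"
    using assms unfolding rapidly_decreasing_def by meson
  have "(1 + norm x) ^ k * norm (f x + g x) \<le> C + D" for x
  proof -
    have "(1 + norm x) ^ k * norm (f x + g x) \<le> (1 + norm x) ^ k * (norm (f x) + norm (g x))"
      by (intro mult_left_mono norm_triangle_ineq) simp
    then show ?thesis using C[of x] D[of x] by (simp add: distrib_left)
  qed
  then show "\<exists>C. \<forall>x. (1 + norm x) ^ k * norm (f x + g x) \<le> C" by blast
qed

lemma rapidly_decreasing_mult_bounded:
  assumes "rapidly_decreasing f" "\<And>x. norm (g x) \<le> B"
  shows "rapidly_decreasing (\<lambda>x. g x * f x)"
  unfolding rapidly_decreasing_def
proof
  fix k :: nat
  obtain C where C: "\<And>x. (1 + norm x) ^ k * norm (f x) \<le> C"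
    using assms unfolding rapidly_decreasing_def by meson
  have "(1 + norm x) ^ k * norm (g x * f x) \<le> B * C" for x
  proof -
    have "norm (g x) * ((1 + norm x) ^ k * norm (f x)) \<le> B * C"
      by (intro mult_mono assms C) (auto intro: order_trans[OF _ assms(2)])
    then show ?thesis by (simp add: norm_mult mult_ac)
  qed
  then show "\<exists>C. \<forall>x. (1 + norm x) ^ k * norm (g x * f x) \<le> C" by blast
qed

lemma rapidly_decreasing_inner_mult:
  assumes "rapidly_decreasing f"
  shows "rapidly_decreasing (\<lambda>x. complex_of_real (x \<bullet> c) * f x)"
  unfolding rapidly_decreasing_def
proof
  fix k :: nat
  obtain C where C: "\<And>x. (1 + norm x) ^ Suc k * norm (f x) \<le> C"
    using assms unfolding rapidly_decreasing_def by meson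
  have "(1 + norm x) ^ k * norm (complex_of_real (x \<bullet> c) * f x) \<le> norm c * C" for x
  proof -
    have "\<bar>x \<bullet> c\<bar> \<le> (1 + norm x) * norm c"
      using Cauchy_Schwarz_ineq2[of x c] mult_right_mono[of "norm x" "1 + norm x" "norm c"] by simp
    then have "\<bar>x \<bullet> c\<bar> * ((1 + norm x) ^ k * norm (f x))
        \<le> ((1 + norm x) * norm c) * ((1 + norm x) ^ k * norm (f x))"
      by (rule mult_right_mono) simp
    also have "\<dots> = norm c * ((1 + norm x) ^ Suc k * norm (f x))" by (simp add: mult_ac)
    also have "\<dots> \<le> norm c * C" by (intro mult_left_mono C) simp
    finally show ?thesis by (simp add: norm_mult mult_ac)
  qed
  then show "\<exists>C. \<forall>x. (1 + norm x) ^ k * norm (complex_of_real (x \<bullet> c) * f x) \<le> C" by blast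
qed

lemma rapidly_decreasing_translate:
  assumes "rapidly_decreasing f"
  shows "rapidly_decreasing (\<lambda>x. f (x - a))"
  unfolding rapidly_decreasing_def
proof
  fix k :: nat
  obtain C where C: "\<And>x. (1 + norm x) ^ k * norm (f x) \<le> C"
    using assms unfolding rapidly_decreasing_def by meson
  have "(1 + norm x) ^ k * norm (f (x - a)) \<le> (1 + norm a) ^ k * C" for x
  proof -
    have "norm x \<le> norm (x - a) + norm a" by (metis diff_add_cancel norm_triangle_ineq)
    moreover have "0 \<le> norm a * norm (x - a)" by simp
    ultimately have "1 + norm x \<le> (1 + norm a) * (1 + norm (x - a))"
      unfolding ring_distribs by linarith
    then have "(1 + norm x) ^ k \<le> ((1 + norm a) * (1 + norm (x - a))) ^ k"
      by (intro power_mono) auto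
    then have "(1 + norm x) ^ k * norm (f (x - a))
        \<le> ((1 + norm a) * (1 + norm (x - a))) ^ k * norm (f (x - a))"
      by (rule mult_right_mono) simp
    also have "\<dots> = (1 + norm a) ^ k * ((1 + norm (x - a)) ^ k * norm (f (x - a)))"
      by (simp add: power_mult_distrib)
    also have "\<dots> \<le> (1 + norm a) ^ k * C" by (intro mult_left_mono C) simp
    finally show ?thesis .
  qed
  then show "\<exists>C. \<forall>x. (1 + norm x) ^ k * norm (f (x - a)) \<le> C" by blast
qed

lemma rapidly_decreasing_bounded:
  assumes "rapidly_decreasing f"
  obtains B where "\<And>x. norm (f x) \<le> B"
  using assms unfolding rapidly_decreasing_def by (metis mult_1 power_0)

lemma schwartz_iff:
  "schwartz f \<longleftrightarrow> (\<forall>bs. set bs \<subseteq> Basis \<longrightarrow>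
     (\<forall>x. iter_partial bs f differentiable (at x)) \<and> rapidly_decreasing (iter_partial bs f))"
proof -
  have "bounded (range (\<lambda>x. (1 + norm x) ^ k *\<^sub>R h x)) \<longleftrightarrow>
      (\<exists>C. \<forall>x. (1 + norm x) ^ k * norm (h x) \<le> C)" for k and h :: "'a \<Rightarrow> complex"
    unfolding bounded_iff by (simp add: abs_mult power_abs)
  then show ?thesis unfolding schwartz_def rapidly_decreasing_def by simp
qed

text \<open>
A coinduction principle: membership of all iterated partial derivatives in a class \<open>X\<close> follows by
induction on the list of directions. It spares any formula for the derivatives of order higher than
one in the closure properties below.
\<close>

lemma schwartz_coinduct:
  assumes "f \<in> X"
    and "\<And>h x. h \<in> X \<Longrightarrow> h differentiable (at x)"
    and "\<And>h. h \<in> X \<Longrightarrow> rapidly_decreasing h"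
    and "\<And>h b. h \<in> X \<Longrightarrow> b \<in> Basis \<Longrightarrow> (\<lambda>x. frechet_derivative h (at x) b) \<in> X"
  shows "schwartz f"
proof -
  have "iter_partial bs f \<in> X" if "set bs \<subseteq> Basis" for bs
    using that by (induction bs) (auto simp: assms)
  then show ?thesis unfolding schwartz_iff using assms(2,3) by blast
qed

lemma schwartz_differentiable: "schwartz f \<Longrightarrow> f differentiable (at x)"
  unfolding schwartz_iff by (drule spec[of _ "[]"]) simp

lemma schwartz_has_derivative:
  "schwartz f \<Longrightarrow> (f has_derivative frechet_derivative f (at x)) (at x)"
  using schwartz_differentiable frechet_derivative_works by blast

lemma schwartz_rapidly_decreasing: "schwartz f \<Longrightarrow> rapidly_decreasing f"
  unfolding schwartz_iff by (drule spec[of _ "[]"]) simp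

lemma schwartz_continuous_on: "schwartz f \<Longrightarrow> continuous_on S f"
  using continuous_at_imp_continuous_on[of S f] differentiable_imp_continuous_within[of f]
    schwartz_differentiable[of f] by fast

lemma schwartz_measurable: "schwartz f \<Longrightarrow> f \<in> borel_measurable borel"
  by (simp add: borel_measurable_continuous_onI schwartz_continuous_on)

lemma schwartz_partial:
  assumes "schwartz f" "b \<in> Basis"
  shows "schwartz (\<lambda>x. frechet_derivative f (at x) b)"
proof -
  have "iter_partial bs (\<lambda>x. frechet_derivative f (at x) b) = iter_partial (bs @ [b]) f" for bs
    by (induction bs) auto
  then show ?thesis using assms unfolding schwartz_iff by simp
qed

lemma schwartz_add:
  assumes "schwartz f" "schwartz g"
  shows "schwartz (\<lambda>x. f x + g x)"
proof (rule schwartz_coinduct[where X = "{\<lambda>x. u x + v x |u v. schwartz u \<and> schwartz v}"])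
  fix h :: "'a \<Rightarrow> complex" and x b :: 'a
  assume "h \<in> {\<lambda>x. u x + v x |u v. schwartz u \<and> schwartz v}"
  then obtain u v where h: "h = (\<lambda>x. u x + v x)" "schwartz u" "schwartz v" by blast
  have d: "(h has_derivative (\<lambda>e. frechet_derivative u (at y) e + frechet_derivative v (at y) e)) (at y)"
    for y unfolding h(1) using h by (intro has_derivative_add schwartz_has_derivative)
  then show "h differentiable (at x)" unfolding differentiable_def by blast
  show "rapidly_decreasing h"
    using h by (simp add: rapidly_decreasing_add schwartz_rapidly_decreasing)
  assume "b \<in> Basis"
  then show "(\<lambda>x. frechet_derivative h (at x) b) \<in> {\<lambda>x. u x + v x |u v. schwartz u \<and> schwartz v}"
    using frechet_derivative_at[OF d, symmetric] h schwartz_partial by fastforce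
qed (use assms in auto)

lemma schwartz_cmult:
  assumes "schwartz f"
  shows "schwartz (\<lambda>x. c * f x)"
proof (rule schwartz_coinduct[where X = "(\<lambda>u x. c * u x) ` Collect schwartz"])
  fix h :: "'a \<Rightarrow> complex" and x b :: 'a
  assume "h \<in> (\<lambda>u x. c * u x) ` Collect schwartz"
  then obtain u where h: "h = (\<lambda>x. c * u x)" "schwartz u" by blast
  have d: "(h has_derivative (\<lambda>e. c * frechet_derivative u (at y) e)) (at y)" for y
    unfolding h(1) using h by (intro has_derivative_mult_right schwartz_has_derivative)
  then show "h differentiable (at x)" unfolding differentiable_def by blast
  show "rapidly_decreasing h"
    unfolding h(1) using h(2)
    by (intro rapidly_decreasing_mult_bounded[where B = "norm c"] schwartz_rapidly_decreasing) auto
  assume "b \<in> Basis"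
  then show "(\<lambda>x. frechet_derivative h (at x) b) \<in> (\<lambda>u x. c * u x) ` Collect schwartz"
    unfolding frechet_derivative_at[OF d, symmetric]
    by (intro image_eqI[OF refl] CollectI schwartz_partial h(2))
qed (use assms in simp)

text \<open>
The derivative of \<open>e\<^sub>\<xi> u\<close>, for the character \<open>e\<^sub>\<xi>\<close> of frequency \<open>\<xi>\<close>, is \<open>e\<^sub>\<xi> (\<i> (\<xi> \<bullet> b) u + \<partial>\<^sub>b u)\<close>, so the
functions of the form \<open>e\<^sub>\<xi> u\<close> with \<open>u\<close> Schwartz are closed under partial derivatives.
\<close>

lemma schwartz_modulate:
  assumes "schwartz f"
  shows "schwartz (\<lambda>x. c * exp (\<i> * complex_of_real (\<xi> \<bullet> x)) * f x)"
proof (rule schwartz_coinduct[where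
      X = "(\<lambda>u x. c * exp (\<i> * complex_of_real (\<xi> \<bullet> x)) * u x) ` Collect schwartz"])
  fix h :: "'a \<Rightarrow> complex" and x b :: 'a
  let ?X = "(\<lambda>u x. c * exp (\<i> * complex_of_real (\<xi> \<bullet> x)) * u x) ` Collect schwartz"
  assume "h \<in> ?X"
  then obtain u where h: "h = (\<lambda>x. c * exp (\<i> * complex_of_real (\<xi> \<bullet> x)) * u x)" "schwartz u"
    by blast
  show "rapidly_decreasing h"
    unfolding h(1) using h(2)
    by (intro rapidly_decreasing_mult_bounded[where B = "norm c"] schwartz_rapidly_decreasing)
       (auto simp: norm_mult)
  have e: "((\<lambda>x. exp (\<i> * complex_of_real (\<xi> \<bullet> x))) has_derivative
      (\<lambda>e. exp (\<i> * complex_of_real (\<xi> \<bullet> y)) * (\<i> * complex_of_real (\<xi> \<bullet> e)))) (at y)" for y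
  proof -
    have "((\<lambda>x. \<i> * complex_of_real (\<xi> \<bullet> x)) has_derivative
        (\<lambda>e. \<i> * complex_of_real (\<xi> \<bullet> e))) (at y)"
      by (auto intro!: derivative_eq_intros)
    from has_derivative_compose[OF this DERIV_exp[unfolded has_field_derivative_def]]
    show ?thesis .
  qed
  have d: "(h has_derivative (\<lambda>e. c * exp (\<i> * complex_of_real (\<xi> \<bullet> y)) *
      (\<i> * complex_of_real (\<xi> \<bullet> e) * u y + frechet_derivative u (at y) e))) (at y)" for y
    unfolding h(1) using schwartz_has_derivative[OF h(2), of y]
    by (auto intro!: derivative_eq_intros e simp: algebra_simps)
  then show "h differentiable (at x)" unfolding differentiable_def by blast
  assume b: "b \<in> Basis"
  have "schwartz (\<lambda>y. \<i> * complex_of_real (\<xi> \<bullet> b) * u y + frechet_derivative u (at y) b)"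
    by (intro schwartz_add schwartz_cmult schwartz_partial h(2) b)
  then show "(\<lambda>x. frechet_derivative h (at x) b) \<in> ?X"
    unfolding frechet_derivative_at[OF d, symmetric]
    by (intro image_eqI[OF refl] CollectI)
qed (use assms in simp)

lemma schwartz_translate:
  assumes "schwartz f"
  shows "schwartz (\<lambda>x. f (x - a))"
proof (rule schwartz_coinduct[where X = "(\<lambda>u x. u (x - a)) ` Collect schwartz"])
  fix h :: "'a \<Rightarrow> complex" and x b :: 'a
  assume "h \<in> (\<lambda>u x. u (x - a)) ` Collect schwartz"
  then obtain u where h: "h = (\<lambda>x. u (x - a))" "schwartz u" by blast
  show "rapidly_decreasing h"
    unfolding h(1) using h(2) by (intro rapidly_decreasing_translate schwartz_rapidly_decreasing)
  have d: "(h has_derivative frechet_derivative u (at (y - a))) (at y)" for y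
  proof -
    have "((\<lambda>x. x - a) has_derivative (\<lambda>e. e)) (at y)" by (auto intro!: derivative_eq_intros)
    from has_derivative_compose[OF this schwartz_has_derivative[OF h(2)]]
    show ?thesis unfolding h(1) .
  qed
  then show "h differentiable (at x)" unfolding differentiable_def by blast
  assume b: "b \<in> Basis"
  show "(\<lambda>x. frechet_derivative h (at x) b) \<in> (\<lambda>u x. u (x - a)) ` Collect schwartz"
    unfolding frechet_derivative_at[OF d, symmetric]
    by (rule image_eqI[OF refl]) (simp add: schwartz_partial[OF h(2) b])
qed (use assms in simp)

lemma schwartz_sum:
  assumes "finite I" "I \<noteq> {}" "\<And>i. i \<in> I \<Longrightarrow> schwartz (F i)"
  shows "schwartz (\<lambda>x. \<Sum>i\<in>I. F i x)"
  using assms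
proof (induction I rule: finite_ne_induct)
  case (insert i I)
  then show ?case by (auto intro: schwartz_add)
qed simp

text \<open>
The direction is arbitrary: the directions \<open>T b\<close> and \<open>T b - b\<close> that integration by parts produces
are not basis vectors.
\<close>

lemma schwartz_directional_derivative:
  assumes "schwartz f"
  shows "schwartz (\<lambda>x. frechet_derivative f (at x) v)"
proof -
  have "frechet_derivative f (at x) v
      = (\<Sum>b\<in>Basis. complex_of_real (v \<bullet> b) * frechet_derivative f (at x) b)" for x
  proof -
    have l: "linear (frechet_derivative f (at x))"
      using schwartz_has_derivative[OF assms] by (rule has_derivative_linear)
    have "frechet_derivative f (at x) v = frechet_derivative f (at x) (\<Sum>b\<in>Basis. (v \<bullet> b) *\<^sub>R b)"
      by (simp add: euclidean_representation)
    then show ?thesis by (simp add: linear_sum[OF l] linear_cmul[OF l] scaleR_conv_of_real)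
  qed
  moreover have "schwartz (\<lambda>x.
      (\<Sum>b\<in>Basis. complex_of_real (v \<bullet> b) * frechet_derivative f (at x) b))"
    using assms by (intro schwartz_sum schwartz_cmult schwartz_partial) auto
  ultimately show ?thesis by presburger
qed

definition gaussian :: "'a::euclidean_space \<Rightarrow> complex" where
  "gaussian x = complex_of_real (exp (- (x \<bullet> x)))"

text \<open>
All polynomial multiples of the Gaussian, generated in such a way that closure under derivatives is a
rule induction.
\<close>

inductive_set polynomial_gaussian :: "('a::euclidean_space \<Rightarrow> complex) set" where
  polynomial_gaussian_gaussian: "gaussian \<in> polynomial_gaussian"
| polynomial_gaussian_inner: "h \<in> polynomial_gaussian \<Longrightarrow> (\<lambda>x. complex_of_real (x \<bullet> c) * h x) \<in> polynomial_gaussian"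
| polynomial_gaussian_cmult: "h \<in> polynomial_gaussian \<Longrightarrow> (\<lambda>x. a * h x) \<in> polynomial_gaussian"
| polynomial_gaussian_add: "h \<in> polynomial_gaussian \<Longrightarrow> k \<in> polynomial_gaussian \<Longrightarrow> (\<lambda>x. h x + k x) \<in> polynomial_gaussian"

lemma rapidly_decreasing_gaussian: "rapidly_decreasing gaussian"
  unfolding rapidly_decreasing_def
proof
  fix k :: nat
  have "(1 + norm x) ^ k * norm (gaussian x) \<le> exp ((real k / 2)\<^sup>2)" for x :: 'a
  proof -
    have "(1 + norm x) ^ k \<le> exp (norm x) ^ k"
      by (rule power_mono[OF exp_ge_add_one_self]) simp
    also have "\<dots> = exp (real k * norm x)" by (rule exp_of_nat_mult[symmetric])
    finally have "(1 + norm x) ^ k * norm (gaussian x) \<le> exp (real k * norm x) * exp (- (x \<bullet> x))"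
      unfolding gaussian_def norm_of_real abs_exp_cancel by (rule mult_right_mono) simp
    also have "\<dots> = exp (real k * norm x - (norm x)\<^sup>2)"
      by (simp add: mult_exp_exp power2_norm_eq_inner)
    \<comment> \<open>The exponent is largest at \<open>norm x = k / 2\<close>: complete the square.\<close>
    also have "\<dots> \<le> exp ((real k / 2)\<^sup>2)"
      using zero_le_power2[of "norm x - real k / 2"] by (simp add: power2_diff algebra_simps)
    finally show ?thesis .
  qed
  then show "\<exists>C. \<forall>x::'a. (1 + norm x) ^ k * norm (gaussian x) \<le> C" by blast
qed

lemma rapidly_decreasing_polynomial_gaussian: "h \<in> polynomial_gaussian \<Longrightarrow> rapidly_decreasing h"
proof (induction rule: polynomial_gaussian.induct)
  case (polynomial_gaussian_cmult h a)
  then show ?case using rapidly_decreasing_mult_bounded[of h "\<lambda>_. a" "norm a"] by simp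
qed (simp_all add: rapidly_decreasing_gaussian rapidly_decreasing_inner_mult rapidly_decreasing_add)

lemma polynomial_gaussian_has_derivative:
  assumes "h \<in> polynomial_gaussian"
  shows "\<exists>D. \<forall>x. (h has_derivative (\<lambda>e. D e x)) (at x) \<and> (\<forall>e. D e \<in> polynomial_gaussian)"
  using assms
proof induction
  case polynomial_gaussian_gaussian
  let ?D = "\<lambda>e x. (-2) * (complex_of_real (x \<bullet> e) * gaussian x)"
  have "(gaussian has_derivative (\<lambda>e. ?D e x)) (at x)" for x :: 'a
    unfolding gaussian_def
    by (auto intro!: derivative_eq_intros simp: inner_commute)
  moreover have "?D e \<in> polynomial_gaussian" for e :: 'a by (intro polynomial_gaussian.intros)
  ultimately show ?case by (intro exI[of _ ?D]) blast
next
  case (polynomial_gaussian_inner h c)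
  then obtain D where D: "\<And>x. (h has_derivative (\<lambda>e. D e x)) (at x)" "\<And>e. D e \<in> polynomial_gaussian" by blast
  let ?D = "\<lambda>e x. complex_of_real (x \<bullet> c) * D e x + complex_of_real (e \<bullet> c) * h x"
  have "((\<lambda>x. complex_of_real (x \<bullet> c) * h x) has_derivative (\<lambda>e. ?D e x)) (at x)" for x
    using D(1)[of x] by (auto intro!: derivative_eq_intros)
  moreover have "?D e \<in> polynomial_gaussian" for e
  proof -
    have "(\<lambda>x. complex_of_real (x \<bullet> c) * D e x) \<in> polynomial_gaussian" by (intro polynomial_gaussian.intros D)
    moreover have "(\<lambda>x. complex_of_real (e \<bullet> c) * h x) \<in> polynomial_gaussian"
      using polynomial_gaussian_inner by (intro polynomial_gaussian.polynomial_gaussian_cmult)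
    ultimately show ?thesis by (rule polynomial_gaussian.polynomial_gaussian_add)
  qed
  ultimately show ?case by (intro exI[of _ ?D]) blast
next
  case (polynomial_gaussian_cmult h a)
  then obtain D where D: "\<And>x. (h has_derivative (\<lambda>e. D e x)) (at x)" "\<And>e. D e \<in> polynomial_gaussian" by blast
  let ?D = "\<lambda>e x. a * D e x"
  have "((\<lambda>x. a * h x) has_derivative (\<lambda>e. ?D e x)) (at x)" for x
    using D(1)[of x] by (auto intro!: derivative_eq_intros)
  moreover have "?D e \<in> polynomial_gaussian" for e by (intro polynomial_gaussian.polynomial_gaussian_cmult D)
  ultimately show ?case by (intro exI[of _ ?D]) blast
next
  case (polynomial_gaussian_add h k)
  obtain D where D: "\<And>x. (h has_derivative (\<lambda>e. D e x)) (at x)" "\<And>e. D e \<in> polynomial_gaussian"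
    using polynomial_gaussian_add by blast
  obtain E where E: "\<And>x. (k has_derivative (\<lambda>e. E e x)) (at x)" "\<And>e. E e \<in> polynomial_gaussian"
    using polynomial_gaussian_add by blast
  let ?D = "\<lambda>e x. D e x + E e x"
  have "((\<lambda>x. h x + k x) has_derivative (\<lambda>e. ?D e x)) (at x)" for x
    by (intro has_derivative_add D E)
  moreover have "?D e \<in> polynomial_gaussian" for e by (intro polynomial_gaussian.polynomial_gaussian_add D E)
  ultimately show ?case by (intro exI[of _ ?D]) blast
qed

lemma schwartz_gaussian: "schwartz gaussian"
proof (rule schwartz_coinduct[where X = polynomial_gaussian])
  fix h :: "'a \<Rightarrow> complex" and x b :: 'a
  assume h: "h \<in> polynomial_gaussian"
  then show "rapidly_decreasing h" by (rule rapidly_decreasing_polynomial_gaussian)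
  obtain D where D: "\<And>x. (h has_derivative (\<lambda>e. D e x)) (at x)" "\<And>e. D e \<in> polynomial_gaussian"
    using polynomial_gaussian_has_derivative[OF h] by blast
  then show "h differentiable (at x)" unfolding differentiable_def by blast
  have "(\<lambda>x. frechet_derivative h (at x) b) = D b"
    by (rule ext) (simp add: frechet_derivative_at[OF D(1), symmetric])
  then show "(\<lambda>x. frechet_derivative h (at x) b) \<in> polynomial_gaussian" using D(2) by simp
qed (rule polynomial_gaussian_gaussian)

section \<open>Integration on Euclidean spaces\<close>

lemma
  fixes f :: "'a::euclidean_space \<Rightarrow> real \<Rightarrow> 'b::{real_normed_field,banach,second_countable_topology}"
  assumes "\<And>b. b \<in> Basis \<Longrightarrow> integrable lborel (f b)"
  shows integrable_lborel_prod: "integrable lborel (\<lambda>x::'a. \<Prod>b\<in>Basis. f b (x \<bullet> b))"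
    and integral_lborel_prod: "(\<integral>x. (\<Prod>b\<in>Basis. f b (x \<bullet> b)) \<partial>lborel) = (\<Prod>b\<in>Basis. \<integral>t. f b t \<partial>lborel)"
proof -
  interpret product_sigma_finite "\<lambda>_::'a. lborel :: real measure" ..
  have [measurable]: "f b \<in> borel_measurable borel" if "b \<in> Basis" for b
    using assms[OF that] by (simp add: integrable_iff_bounded)
  let ?P = "\<Pi>\<^sub>M b\<in>(Basis :: 'a set). (lborel :: real measure)"
  let ?s = "\<lambda>u::'a \<Rightarrow> real. \<Sum>b\<in>Basis. u b *\<^sub>R b"
  have s: "(\<Prod>b\<in>Basis. f b (?s u \<bullet> b)) = (\<Prod>b\<in>Basis. f b (u b))" for u
    by (intro prod.cong refl) (simp add: inner_sum_left inner_Basis if_distrib cong: if_cong)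
  have [measurable]: "?s \<in> measurable ?P borel" by measurable
  have [measurable]: "(\<lambda>x::'a. \<Prod>b\<in>Basis. f b (x \<bullet> b)) \<in> borel_measurable borel" by measurable
  have "integrable ?P (\<lambda>u. \<Prod>b\<in>Basis. f b (u b))"
    by (rule product_integrable_prod) (use assms in auto)
  then show "integrable lborel (\<lambda>x::'a. \<Prod>b\<in>Basis. f b (x \<bullet> b))"
    by (subst lborel_eq) (simp add: integrable_distr_eq s del: inner_sum_left)
  have "(\<integral>x. (\<Prod>b\<in>Basis. f b (x \<bullet> b)) \<partial>lborel) = (\<integral>u. (\<Prod>b\<in>Basis. f b (u b)) \<partial>?P)"
    by (subst lborel_eq) (simp add: integral_distr s del: inner_sum_left)
  also have "\<dots> = (\<Prod>b\<in>Basis. \<integral>t. f b t \<partial>lborel)"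
    by (rule product_integral_prod) (use assms in auto)
  finally show "(\<integral>x. (\<Prod>b\<in>Basis. f b (x \<bullet> b)) \<partial>lborel) = (\<Prod>b\<in>Basis. \<integral>t. f b t \<partial>lborel)" .
qed

text \<open>
The exponent is chosen so that the weight is dominated by the product of the one-dimensional weights
\<open>1 / (1 + x\<^sub>b\<^sup>2)\<close>: each of the \<open>DIM('a)\<close> factors uses up two powers of \<open>1 + norm x\<close>.
\<close>

lemma integrable_inverse_power_norm:
  "integrable lborel (\<lambda>x::'a::euclidean_space. 1 / (1 + norm x) ^ (2 * DIM('a)))"
proof (rule Bochner_Integration.integrable_bound)
  have "integrable lborel (\<lambda>x. 1 / (1 + x\<^sup>2) :: real)"
  proof -
    have "set_integrable lborel (einterval (-\<infinity>) \<infinity>) (\<lambda>x. 1 / (1 + x\<^sup>2) :: real)"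
      using integrable_inverse_1_plus_square by (simp add: inverse_eq_divide)
    then show ?thesis unfolding set_integrable_def by (simp add: einterval_eq)
  qed
  then show "integrable lborel (\<lambda>x::'a. \<Prod>b\<in>Basis. 1 / (1 + (x \<bullet> b)\<^sup>2))"
    by (rule integrable_lborel_prod)
  have "1 / (1 + norm x) ^ (2 * DIM('a)) \<le> (\<Prod>b\<in>Basis. 1 / (1 + (x \<bullet> b)\<^sup>2))" for x :: 'a
  proof -
    have "1 / (1 + norm x)\<^sup>2 \<le> 1 / (1 + (x \<bullet> b)\<^sup>2)" if "b \<in> Basis" for b
    proof (rule divide_left_mono)
      have "\<bar>x \<bullet> b\<bar> \<le> norm x" using that by (rule Basis_le_norm)
      then have "(x \<bullet> b)\<^sup>2 \<le> (norm x)\<^sup>2" by (simp add: abs_le_square_iff[symmetric])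
      then show "1 + (x \<bullet> b)\<^sup>2 \<le> (1 + norm x)\<^sup>2" unfolding power2_sum using norm_ge_zero[of x] by (simp del: norm_ge_zero)
    qed (simp, intro mult_pos_pos zero_less_power add_pos_nonneg, auto)
    then have "(\<Prod>b\<in>(Basis::'a set). 1 / (1 + norm x)\<^sup>2) \<le> (\<Prod>b\<in>Basis. 1 / (1 + (x \<bullet> b)\<^sup>2))"
      by (intro prod_mono) auto
    then show ?thesis by (simp add: power_mult[symmetric] power_one_over)
  qed
  then show "AE x in lborel. norm (1 / (1 + norm (x::'a)) ^ (2 * DIM('a)))
      \<le> norm (\<Prod>b\<in>Basis. 1 / (1 + (x \<bullet> b)\<^sup>2))"
    by (auto intro!: AE_I2 order_trans[OF _ abs_ge_self])
qed measurable

lemma rapidly_decreasing_integrable: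
  fixes f :: "'a::euclidean_space \<Rightarrow> complex"
  assumes "rapidly_decreasing f" "f \<in> borel_measurable borel"
  shows "integrable lborel f"
proof -
  obtain C where C: "\<And>x. (1 + norm x) ^ (2 * DIM('a)) * norm (f x) \<le> C"
    using assms unfolding rapidly_decreasing_def by meson
  show ?thesis
  proof (rule Bochner_Integration.integrable_bound)
    show "integrable lborel (\<lambda>x::'a. C * (1 / (1 + norm x) ^ (2 * DIM('a))))"
      by (intro integrable_mult_right integrable_inverse_power_norm)
    have "norm (f x) \<le> C * (1 / (1 + norm x) ^ (2 * DIM('a)))" for x
      using C[of x] by (simp add: pos_le_divide_eq mult.commute add_pos_nonneg)
    then have "norm (f x) \<le> norm (C * (1 / (1 + norm x) ^ (2 * DIM('a))))" for x
      unfolding real_norm_def by (rule order_trans[OF _ abs_ge_self])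
    then show "AE x in lborel. norm (f x) \<le> norm (C * (1 / (1 + norm x) ^ (2 * DIM('a))))"
      by simp
  qed (use assms in simp)
qed

lemma
  fixes f :: "'a::euclidean_space \<Rightarrow> 'b::{banach,second_countable_topology}"
  assumes [measurable]: "f \<in> borel_measurable borel" and c: "c \<noteq> 0"
  shows integral_lborel_affine: "(\<integral>x. f x \<partial>lborel) = \<bar>c\<bar> ^ DIM('a) *\<^sub>R (\<integral>x. f (t + c *\<^sub>R x) \<partial>lborel)"
    and integrable_lborel_affine: "integrable lborel (\<lambda>x. f (t + c *\<^sub>R x)) \<longleftrightarrow> integrable lborel f"
proof -
  let ?D = "density (distr lborel borel (\<lambda>x::'a. t + c *\<^sub>R x)) (\<lambda>_. ennreal (\<bar>c\<bar> ^ DIM('a)))"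
  have "(\<integral>x. f x \<partial>?D) = \<bar>c\<bar> ^ DIM('a) *\<^sub>R (\<integral>x. f (t + c *\<^sub>R x) \<partial>lborel)"
    by (simp add: integral_density integral_distr)
  then show "(\<integral>x. f x \<partial>lborel) = \<bar>c\<bar> ^ DIM('a) *\<^sub>R (\<integral>x. f (t + c *\<^sub>R x) \<partial>lborel)"
    using lborel_affine[OF c, of t] by simp
  have "integrable ?D f \<longleftrightarrow> integrable lborel (\<lambda>x. f (t + c *\<^sub>R x))"
  proof -
    have "integrable lborel (\<lambda>x. k *\<^sub>R g x) \<longleftrightarrow> integrable lborel g" if "k \<noteq> 0"
      for k and g :: "'a \<Rightarrow> 'b"
    proof
      assume "integrable lborel (\<lambda>x. k *\<^sub>R g x)"
      then have "integrable lborel (\<lambda>x. inverse k *\<^sub>R k *\<^sub>R g x)" by (rule integrable_scaleR_right)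
      then show "integrable lborel g" using that by simp
    qed (rule integrable_scaleR_right)
    then show ?thesis using c by (simp add: integrable_density integrable_distr_eq)
  qed
  then show "integrable lborel (\<lambda>x. f (t + c *\<^sub>R x)) \<longleftrightarrow> integrable lborel f"
    using lborel_affine[OF c, of t] by simp
qed

lemma integral_lborel_translate:
  fixes f :: "'a::euclidean_space \<Rightarrow> 'b::{banach,second_countable_topology}"
  assumes "f \<in> borel_measurable borel"
  shows "(\<integral>x. f (x + t) \<partial>lborel) = (\<integral>x. f x \<partial>lborel)"
  using integral_lborel_affine[OF assms, of 1 t] by (simp add: add.commute)

lemma integral_lborel_reflect:
  fixes f :: "'a::euclidean_space \<Rightarrow> 'b::{banach,second_countable_topology}"
  assumes "f \<in> borel_measurable borel"
  shows "(\<integral>x. f (t - x) \<partial>lborel) = (\<integral>x. f x \<partial>lborel)"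
  using integral_lborel_affine[OF assms, of "-1" t] by simp

lemma integrable_lborel_translate:
  fixes f :: "'a::euclidean_space \<Rightarrow> 'b::{banach,second_countable_topology}"
  assumes "f \<in> borel_measurable borel"
  shows "integrable lborel (\<lambda>x. f (x + t)) \<longleftrightarrow> integrable lborel f"
  using integrable_lborel_affine[OF assms, of 1 t] by (simp add: add.commute)

lemma integrable_mult_bounded:
  fixes f g :: "'a \<Rightarrow> 'b::{real_normed_field,banach,second_countable_topology}"
  assumes f: "integrable M f" and g: "g \<in> borel_measurable M" "\<And>x. norm (g x) \<le> B"
  shows "integrable M (\<lambda>x. f x * g x)"
proof (rule Bochner_Integration.integrable_bound)
  show "integrable M (\<lambda>x. B * norm (f x))" using f by simp
  have "norm (f x * g x) \<le> norm (B * norm (f x))" for x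
  proof -
    have "norm (f x) * norm (g x) \<le> norm (f x) * B" by (intro mult_left_mono g) simp
    then have "norm (f x * g x) \<le> B * norm (f x)" by (simp add: norm_mult mult.commute)
    then show ?thesis unfolding real_norm_def by (rule order_trans[OF _ abs_ge_self])
  qed
  then show "AE x in M. norm (f x * g x) \<le> norm (B * norm (f x))" by simp
qed (use f g(1) in simp)

lemma integrable_times_pair:
  fixes f g :: "'a::euclidean_space \<Rightarrow> complex"
  assumes f: "integrable lborel f" and g: "integrable lborel g"
  shows "integrable (lborel \<Otimes>\<^sub>M lborel) (\<lambda>(x, y). f x * g y)"
proof (rule lborel_pair.Fubini_integrable)
  have [measurable]: "f \<in> borel_measurable borel" "g \<in> borel_measurable borel"
    using f g by simp_all
  show "(\<lambda>(x, y). f x * g y) \<in> borel_measurable (lborel \<Otimes>\<^sub>M lborel)" by measurable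
  show "integrable lborel (\<lambda>x. \<integral>y. norm (case (x, y) of (x, y) \<Rightarrow> f x * g y) \<partial>lborel)"
    using f by (simp add: norm_mult)
  show "AE x in lborel. integrable lborel (\<lambda>y. case (x, y) of (x, y) \<Rightarrow> f x * g y)"
    using g by simp
qed

lemma integral_times_pair:
  fixes f g :: "'a::euclidean_space \<Rightarrow> complex"
  assumes f: "integrable lborel f" and g: "integrable lborel g"
  shows "(\<integral>z. (case z of (x, y) \<Rightarrow> f x * g y) \<partial>(lborel \<Otimes>\<^sub>M lborel)) = (\<integral>x. f x \<partial>lborel) * (\<integral>y. g y \<partial>lborel)"
  by (simp add: lborel_pair.integral_fst'[OF integrable_times_pair[OF f g], symmetric])

lemma measurable_cnj [measurable (raw)]:
  "f \<in> borel_measurable M \<Longrightarrow> (\<lambda>x. cnj (f x)) \<in> borel_measurable M"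
  by (rule measurable_compose[of f M borel cnj borel])
     (auto intro!: borel_measurable_continuous_onI continuous_intros)

lemma linear_measurable: "linear T \<Longrightarrow> T \<in> borel_measurable borel"
  for T :: "'a::euclidean_space \<Rightarrow> 'b::euclidean_space"
  by (simp add: borel_measurable_continuous_onI linear_continuous_on linear_conv_bounded_linear)

text \<open>
For fixed \<open>y\<close> the substitution in \<open>t\<close> is a translation, which leaves \<open>(t, t - y)\<close>; for fixed \<open>t\<close> the
substitution in \<open>y\<close> is then a reflection. Tonelli's theorem combines the two, and \<open>L\<close> only has to be
measurable.
\<close>

lemma distr_lborel_shear:
  fixes L :: "'a::euclidean_space \<Rightarrow> 'a"
  assumes [measurable]: "L \<in> borel_measurable borel"
  shows "distr lborel borel (\<lambda>(t, y). (t + L y, t + L y - y)) = (lborel :: ('a \<times> 'a) measure)"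
proof (rule measure_eqI)
  fix A :: "('a \<times> 'a) set"
  assume "A \<in> sets (distr lborel borel (\<lambda>(t, y). (t + L y, t + L y - y)))"
  then have A: "A \<in> sets borel" by simp
  then have A'[measurable]: "A \<in> sets (borel \<Otimes>\<^sub>M borel)" unfolding borel_prod .
  have tr: "(\<integral>\<^sup>+t. F (t + s) \<partial>lborel) = (\<integral>\<^sup>+t. F t \<partial>lborel)"
    if [measurable]: "F \<in> borel_measurable borel" for F :: "'a \<Rightarrow> ennreal" and s
    using nn_integral_distr[of "(+) s" lborel borel F]
    by (simp add: lborel_distr_plus add.commute)
  have re: "(\<integral>\<^sup>+y. F (t - y) \<partial>lborel) = (\<integral>\<^sup>+y. F y \<partial>lborel)"
    if [measurable]: "F \<in> borel_measurable borel" for F :: "'a \<Rightarrow> ennreal" and t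
  proof -
    have "lborel = distr lborel borel (\<lambda>y::'a. t - y)"
      using lborel_affine[of "-1" t] by (simp add: density_1)
    then show ?thesis using nn_integral_distr[of "\<lambda>y::'a. t - y" lborel borel F] by simp
  qed
  have [measurable]: "(\<lambda>(t, y). (t + L y, t + L y - y)) \<in> (borel :: ('a \<times> 'a) measure) \<rightarrow>\<^sub>M borel"
    unfolding borel_prod[symmetric] by measurable
  have "emeasure (distr lborel borel (\<lambda>(t, y). (t + L y, t + L y - y))) A
      = (\<integral>\<^sup>+z. indicator A z \<partial>distr lborel borel (\<lambda>(t, y). (t + L y, t + L y - y)))"
    using A by simp
  also have "\<dots> = (\<integral>\<^sup>+z. indicator A ((\<lambda>(t, y). (t + L y, t + L y - y)) z) \<partial>(lborel \<Otimes>\<^sub>M lborel))"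
    using A by (subst nn_integral_distr) (auto simp: lborel_prod)
  also have "\<dots> = (\<integral>\<^sup>+y. \<integral>\<^sup>+t. indicator A (t + L y, t + L y - y) \<partial>lborel \<partial>lborel)"
    by (subst lborel_pair.nn_integral_snd[symmetric]) simp_all
  also have "\<dots> = (\<integral>\<^sup>+y. \<integral>\<^sup>+t. indicator A (t, t - y) \<partial>lborel \<partial>lborel)"
    by (intro nn_integral_cong tr[where F = "\<lambda>t. indicator A (t, t - _)"]) measurable
  also have "\<dots> = (\<integral>\<^sup>+t. \<integral>\<^sup>+y. indicator A (t, t - y) \<partial>lborel \<partial>lborel)"
    by (rule lborel_pair.Fubini') simp
  also have "\<dots> = (\<integral>\<^sup>+t. \<integral>\<^sup>+y. indicator A (t, y) \<partial>lborel \<partial>lborel)"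
    by (intro nn_integral_cong re[where F = "\<lambda>y. indicator A (_, y)"]) measurable
  also have "\<dots> = (\<integral>\<^sup>+z. indicator A z \<partial>(lborel \<Otimes>\<^sub>M lborel))"
    by (subst lborel.nn_integral_fst) simp_all
  also have "\<dots> = emeasure lborel A" using A by (simp add: lborel_prod)
  finally show "emeasure (distr lborel borel (\<lambda>(t, y). (t + L y, t + L y - y))) A = emeasure lborel A" .
qed simp

lemma
  fixes T :: "'a::euclidean_space \<Rightarrow> 'a" and H :: "'a \<times> 'a \<Rightarrow> complex"
  assumes T: "linear T" and H: "integrable (lborel \<Otimes>\<^sub>M lborel) H"
  shows integrable_shear: "integrable (lborel \<Otimes>\<^sub>M lborel) (\<lambda>(t, y). H (t + T y, t + T y - y))"
    and integral_shear:
      "(\<integral>z. (case z of (t, y) \<Rightarrow> H (t + T y, t + T y - y)) \<partial>(lborel \<Otimes>\<^sub>M lborel)) = (\<integral>z. H z \<partial>(lborel \<Otimes>\<^sub>M lborel))"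
proof -
  note [measurable] = linear_measurable[OF T]
  let ?S = "\<lambda>(t, y). (t + T y, t + T y - y)"
  have "?S \<in> (borel :: ('a \<times> 'a) measure) \<rightarrow>\<^sub>M borel"
    unfolding borel_prod[symmetric] by measurable
  then have S: "?S \<in> (lborel :: ('a \<times> 'a) measure) \<rightarrow>\<^sub>M borel" by simp
  have Hm: "H \<in> borel_measurable borel" and Hi: "integrable lborel H"
    using H unfolding lborel_prod by simp_all
  have d: "distr lborel borel ?S = (lborel :: ('a \<times> 'a) measure)"
    by (rule distr_lborel_shear) measurable
  show "integrable (lborel \<Otimes>\<^sub>M lborel) (\<lambda>(t, y). H (t + T y, t + T y - y))"
    using integrable_distr_eq[OF S Hm] Hi unfolding d lborel_prod by (simp add: case_prod_unfold)
  show "(\<integral>z. (case z of (t, y) \<Rightarrow> H (t + T y, t + T y - y)) \<partial>(lborel \<Otimes>\<^sub>M lborel)) = (\<integral>z. H z \<partial>(lborel \<Otimes>\<^sub>M lborel))"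
    using integral_distr[OF S Hm] unfolding d lborel_prod by (simp add: case_prod_unfold)
qed

text \<open>
The difference quotients of \<open>h\<close> in direction \<open>b\<close> have integral \<open>0\<close> by translation invariance and
converge pointwise to the derivative. By the mean value inequality they are dominated by a multiple of
the integrable weight, because the derivative is rapidly decreasing and a shift by at most one changes
\<open>1 + norm y\<close> by at most a factor \<open>2\<close>.
\<close>

lemma integral_directional_derivative_eq_0:
  fixes h :: "'a::euclidean_space \<Rightarrow> complex"
  assumes der: "\<And>y. (h has_derivative h' y) (at y)"
    and h: "rapidly_decreasing h" and h': "rapidly_decreasing (\<lambda>y. h' y b)"
    and meas: "(\<lambda>y. h' y b) \<in> borel_measurable borel"
    and b: "norm b = 1"
  shows "(\<integral>y. h' y b \<partial>lborel) = 0"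
proof -
  have "continuous_on UNIV h"
    by (intro continuous_at_imp_continuous_on ballI has_derivative_continuous[OF der])
  then have [measurable]: "h \<in> borel_measurable borel" by (rule borel_measurable_continuous_onI)
  have hint: "integrable lborel h" by (rule rapidly_decreasing_integrable[OF h]) simp
  define \<delta> where "\<delta> n = inverse (real (Suc n))" for n
  have \<delta>: "0 < \<delta> n" "\<delta> n \<le> 1" for n by (auto simp: \<delta>_def inverse_le_1_iff)
  have \<delta>_lim: "\<delta> \<longlonglongrightarrow> 0" unfolding \<delta>_def by (rule LIMSEQ_inverse_real_of_nat)
  define s where "s n y = inverse (\<delta> n) *\<^sub>R (h (y + \<delta> n *\<^sub>R b) - h y)" for n y
  let ?k = "2 * DIM('a)"
  obtain C where C: "\<And>y. (1 + norm y) ^ ?k * norm (h' y b) \<le> C"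
    using h' unfolding rapidly_decreasing_def by meson
  have bnd: "norm (s n y) \<le> 2 ^ ?k * C * (1 / (1 + norm y) ^ ?k)" for n y
  proof -
    have d: "((\<lambda>t. h (y + t *\<^sub>R b)) has_derivative (\<lambda>e. h' (y + t *\<^sub>R b) (e *\<^sub>R b))) (at t)" for t
      by (rule has_derivative_compose[OF _ der]) (auto intro!: derivative_eq_intros)
    then have "\<exists>t\<in>{0<..<\<delta> n}. norm (h (y + \<delta> n *\<^sub>R b) - h (y + 0 *\<^sub>R b))
        \<le> norm (h' (y + t *\<^sub>R b) ((\<delta> n - 0) *\<^sub>R b))"
      by (intro mvt_general \<delta>) (auto intro!: continuous_at_imp_continuous_on has_derivative_continuous)
    then obtain t where t: "0 < t" "t < \<delta> n"
      "norm (h (y + \<delta> n *\<^sub>R b) - h y) \<le> norm (h' (y + t *\<^sub>R b) (\<delta> n *\<^sub>R b))" by auto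
    have "norm (s n y) \<le> inverse (\<delta> n) * norm (h' (y + t *\<^sub>R b) (\<delta> n *\<^sub>R b))"
      unfolding s_def using \<delta>[of n] t(3) by simp
    also have "\<dots> = norm (h' (y + t *\<^sub>R b) b)"
      using \<delta>[of n] linear_cmul[OF has_derivative_linear[OF der], of "y + t *\<^sub>R b" "\<delta> n" b] by simp
    also have "\<dots> \<le> 2 ^ ?k * C * (1 / (1 + norm y) ^ ?k)"
    proof -
      have "norm y \<le> norm (y + t *\<^sub>R b) + norm (t *\<^sub>R b)"
        using norm_triangle_ineq4[of "y + t *\<^sub>R b" "t *\<^sub>R b"] by simp
      then have "1 + norm y \<le> 2 * (1 + norm (y + t *\<^sub>R b))"
        using t \<delta>[of n] b norm_ge_zero[of "y + t *\<^sub>R b"] by (simp del: norm_ge_zero)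
      then have "(1 + norm y) ^ ?k \<le> (2 * (1 + norm (y + t *\<^sub>R b))) ^ ?k"
        by (intro power_mono) auto
      then have "(1 + norm y) ^ ?k * norm (h' (y + t *\<^sub>R b) b)
          \<le> (2 * (1 + norm (y + t *\<^sub>R b))) ^ ?k * norm (h' (y + t *\<^sub>R b) b)"
        by (rule mult_right_mono) simp
      also have "\<dots> = 2 ^ ?k * ((1 + norm (y + t *\<^sub>R b)) ^ ?k * norm (h' (y + t *\<^sub>R b) b))"
        by (simp only: power_mult_distrib mult.assoc)
      also have "\<dots> \<le> 2 ^ ?k * C" by (intro mult_left_mono C) simp
      finally show ?thesis by (simp add: pos_le_divide_eq add_pos_nonneg mult.commute)
    qed
    finally show ?thesis .
  qed
  have "(\<lambda>n. \<integral>y. s n y \<partial>lborel) \<longlonglongrightarrow> (\<integral>y. h' y b \<partial>lborel)"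
  proof (rule integral_dominated_convergence)
    show "integrable lborel (\<lambda>y::'a. 2 ^ ?k * C * (1 / (1 + norm y) ^ ?k))"
      by (intro integrable_mult_right integrable_inverse_power_norm)
    show "AE y in lborel. norm (s n y) \<le> 2 ^ ?k * C * (1 / (1 + norm y) ^ ?k)" for n
      using bnd by simp
    show "AE y in lborel. (\<lambda>n. s n y) \<longlonglongrightarrow> h' y b"
    proof (rule AE_I2)
      fix y
      have "((\<lambda>e. norm (h (y + e) - h y - h' y e) / norm e) \<longlongrightarrow> 0) (at 0)"
        using der[of y] by (simp add: has_derivative_at)
      moreover have "filterlim (\<lambda>n. \<delta> n *\<^sub>R b) (at 0) sequentially"
      proof -
        have "(\<lambda>n. \<delta> n *\<^sub>R b) \<longlonglongrightarrow> 0 *\<^sub>R b" by (intro tendsto_intros \<delta>_lim)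
        moreover have "\<delta> n *\<^sub>R b \<noteq> 0" for n using \<delta>(1)[of n] b by auto
        ultimately show ?thesis by (simp add: filterlim_at)
      qed
      ultimately have "(\<lambda>n. norm (h (y + \<delta> n *\<^sub>R b) - h y - h' y (\<delta> n *\<^sub>R b)) / norm (\<delta> n *\<^sub>R b)) \<longlonglongrightarrow> 0"
        by (rule filterlim_compose)
      moreover have "norm (h (y + \<delta> n *\<^sub>R b) - h y - h' y (\<delta> n *\<^sub>R b)) / norm (\<delta> n *\<^sub>R b)
          = norm (s n y - h' y b)" for n
      proof -
        have "s n y - h' y b = inverse (\<delta> n) *\<^sub>R (h (y + \<delta> n *\<^sub>R b) - h y - h' y (\<delta> n *\<^sub>R b))"
          using \<delta>(1)[of n] linear_cmul[OF has_derivative_linear[OF der], of y "\<delta> n" b]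
          by (simp add: s_def scaleR_diff_right)
        then show ?thesis using \<delta>(1)[of n] b by (simp add: divide_inverse mult.commute)
      qed
      ultimately have "(\<lambda>n. norm (s n y - h' y b)) \<longlonglongrightarrow> 0" by simp
      then show "(\<lambda>n. s n y) \<longlonglongrightarrow> h' y b"
        by (simp add: tendsto_norm_zero_iff LIM_zero_iff)
    qed
    show "s n \<in> borel_measurable lborel" for n unfolding s_def[abs_def] by measurable
  qed (use meas in simp)
  moreover have "(\<integral>y. s n y \<partial>lborel) = 0" for n
  proof -
    have "integrable lborel (\<lambda>y. h (y + \<delta> n *\<^sub>R b))"
      using hint by (subst integrable_lborel_translate) auto
    then show ?thesis unfolding s_def using hint by (simp add: integral_lborel_translate)
  qed
  ultimately show ?thesis by (simp add: LIMSEQ_const_iff)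
qed

section \<open>Fourier inversion\<close>

definition phase :: "real \<Rightarrow> complex" where
  "phase t = cis (2 * pi * t)"

lemma phase_0 [simp]: "phase 0 = 1"
  by (simp add: phase_def)

lemma norm_phase [simp]: "norm (phase t) = 1"
  by (simp add: phase_def)

lemma phase_add: "phase (s + t) = phase s * phase t"
  by (simp add: phase_def cis_mult distrib_left)

lemma phase_minus_mult [simp]: "phase (- t) * phase t = 1" "phase t * phase (- t) = 1"
  by (simp_all add: phase_add[symmetric])

lemma cnj_phase: "cnj (phase t) = phase (- t)"
  by (simp add: phase_def cis_cnj)

lemma continuous_on_phase [continuous_intros]:
  "continuous_on S f \<Longrightarrow> continuous_on S (\<lambda>x. phase (f x))"
  unfolding phase_def by (intro continuous_intros)

lemma measurable_phase [measurable]: "phase \<in> borel_measurable borel"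
  by (intro borel_measurable_continuous_onI continuous_intros)

lemma phase_eq_exp: "phase t = exp (2 * pi * \<i> * complex_of_real t)"
  unfolding phase_def cis_conv_exp by (simp add: mult_ac)

lemma fourier_phase: "fourier f \<omega> = (\<integral>x. phase (- (x \<bullet> \<omega>)) * f x \<partial>lborel)"
  unfolding fourier_def phase_eq_exp by simp

lemma integrable_phase_mult:
  fixes f :: "'a::euclidean_space \<Rightarrow> complex"
  assumes "integrable lborel f" "\<phi> \<in> borel_measurable borel"
  shows "integrable lborel (\<lambda>x. phase (\<phi> x) * f x)"
  by (rule Bochner_Integration.integrable_bound[OF assms(1)])
     (use assms in \<open>auto simp: norm_mult\<close>)

lemma norm_fourier_le: "norm (fourier f \<omega>) \<le> (\<integral>x. norm (f x) \<partial>lborel)"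
  unfolding fourier_phase by (rule order_trans[OF integral_norm_bound]) (simp add: norm_mult)

text \<open>
The density of the standard normal distribution on \<open>'a\<close>. It is used as an approximate identity; up to
a constant and a dilation it is the Fourier transform of \<open>gauss_window\<close>, which is used as a cut-off in frequency.
\<close>

definition normal_kernel :: "'a::euclidean_space \<Rightarrow> real" where
  "normal_kernel x = (\<Prod>b\<in>Basis. std_normal_density (x \<bullet> b))"

definition gauss_window :: "'a::euclidean_space \<Rightarrow> real" where
  "gauss_window x = exp (- (x \<bullet> x) / 2)"

lemma normal_kernel_nonneg: "0 \<le> normal_kernel x"
  unfolding normal_kernel_def by (intro prod_nonneg) auto

lemma measurable_normal_kernel [measurable]: "normal_kernel \<in> borel_measurable borel"
  unfolding normal_kernel_def by measurable

lemma measurable_gauss_window [measurable]: "gauss_window \<in> borel_measurable borel"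
  unfolding gauss_window_def by measurable

lemma integrable_std_normal_density: "integrable lborel std_normal_density"
  by simp

lemma integrable_normal_kernel: "integrable lborel normal_kernel"
  unfolding normal_kernel_def by (rule integrable_lborel_prod) (rule integrable_std_normal_density)

lemma integral_normal_kernel: "(\<integral>x. normal_kernel x \<partial>lborel) = 1"
  unfolding normal_kernel_def
  by (subst integral_lborel_prod) (auto intro: integrable_std_normal_density)

lemma gauss_window_prod: "gauss_window x = (\<Prod>b\<in>Basis. exp (- (x \<bullet> b)\<^sup>2 / 2))"
  unfolding gauss_window_def euclidean_inner[of x x]
  by (simp add: exp_sum[symmetric] sum_negf sum_divide_distrib power2_eq_square)

lemma normal_density_eq: "exp (- t\<^sup>2 / 2) = sqrt (2 * pi) * std_normal_density t"
  by (simp add: std_normal_density_def)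

text \<open>
Both the window and the character factor over the coordinates, so the formula reduces to the
characteristic function of the one-dimensional standard normal distribution.
\<close>

lemma
  fixes z :: "'a::euclidean_space"
  shows integrable_gauss_window: "integrable lborel (gauss_window :: 'a \<Rightarrow> real)"
    and integral_gauss_window:
      "(\<integral>\<eta>. complex_of_real (gauss_window \<eta>) * exp (\<i> * complex_of_real (\<eta> \<bullet> z)) \<partial>lborel)
        = (2 * pi) ^ DIM('a) * normal_kernel z"
proof -
  show "integrable lborel (gauss_window :: 'a \<Rightarrow> real)"
    unfolding gauss_window_prod normal_density_eq
    by (intro integrable_lborel_prod integrable_mult_right integrable_std_normal_density)
  let ?h = "\<lambda>b t. complex_of_real (exp (- t\<^sup>2 / 2)) * exp (\<i> * complex_of_real (t * (z \<bullet> b)))"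
  have h: "integrable lborel (?h b)" for b
  proof (rule Bochner_Integration.integrable_bound)
    show "integrable lborel (\<lambda>t. sqrt (2 * pi) * std_normal_density t)"
      by (intro integrable_mult_right integrable_std_normal_density)
  qed (auto simp: norm_mult std_normal_density_def)
  have i: "(\<integral>t. ?h b t \<partial>lborel) = complex_of_real (2 * pi * std_normal_density (z \<bullet> b))" for b
  proof -
    have c: "(\<integral>t. std_normal_density t *\<^sub>R iexp ((z \<bullet> b) * t) \<partial>lborel) = exp (- (z \<bullet> b)\<^sup>2 / 2)"
      using fun_cong[OF char_std_normal_distribution, of "z \<bullet> b"]
      unfolding char_def by (subst (asm) integral_density) auto
    have e: "?h b t = sqrt (2 * pi) * (std_normal_density t *\<^sub>R iexp ((z \<bullet> b) * t))" for t
      unfolding normal_density_eq by (simp add: scaleR_conv_of_real mult_ac)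
    have "(\<integral>t. ?h b t \<partial>lborel) = complex_of_real (sqrt (2 * pi))
        * (\<integral>t. std_normal_density t *\<^sub>R iexp ((z \<bullet> b) * t) \<partial>lborel)"
      unfolding e by (rule integral_mult_right_zero)
    then have "(\<integral>t. ?h b t \<partial>lborel) = sqrt (2 * pi) * exp (- (z \<bullet> b)\<^sup>2 / 2)"
      unfolding c by (simp only: of_real_mult)
    also have "\<dots> = complex_of_real (2 * pi * std_normal_density (z \<bullet> b))"
      unfolding normal_density_eq mult.assoc[symmetric] of_real_mult[symmetric]
      by (simp del: of_real_mult)
    finally show ?thesis .
  qed
  have "complex_of_real (gauss_window \<eta>) * exp (\<i> * complex_of_real (\<eta> \<bullet> z))
      = (\<Prod>b\<in>Basis. ?h b (\<eta> \<bullet> b))" for \<eta>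
    unfolding gauss_window_prod prod.distrib of_real_prod
    by (simp add: exp_sum[symmetric] euclidean_inner[of \<eta> z] sum_distrib_left)
  then have "(\<integral>\<eta>. complex_of_real (gauss_window \<eta>) * exp (\<i> * complex_of_real (\<eta> \<bullet> z)) \<partial>lborel)
      = (\<Prod>b\<in>Basis. \<integral>t. ?h b t \<partial>lborel)"
    using integral_lborel_prod[of ?h, OF h] by simp
  also have "\<dots> = (2 * pi) ^ DIM('a) * normal_kernel z"
    unfolding i normal_kernel_def by (simp add: prod.distrib)
  finally show "(\<integral>\<eta>. complex_of_real (gauss_window \<eta>) * exp (\<i> * complex_of_real (\<eta> \<bullet> z)) \<partial>lborel)
        = (2 * pi) ^ DIM('a) * normal_kernel z" .
qed

lemma gauss_window_le_1: "gauss_window x \<le> 1" "0 \<le> gauss_window x"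
  unfolding gauss_window_def by auto

lemma integral_scaled_gauss_window:
  fixes z :: "'a::euclidean_space"
  assumes "\<delta> > 0"
  shows "(\<integral>\<eta>. complex_of_real (gauss_window ((2 * pi * \<delta>) *\<^sub>R \<eta>)) * phase (\<eta> \<bullet> z) \<partial>lborel)
    = complex_of_real (inverse \<delta> ^ DIM('a) * normal_kernel (inverse \<delta> *\<^sub>R z))"
proof -
  let ?c = "2 * pi * \<delta>"
  let ?f = "\<lambda>\<eta>::'a. complex_of_real (gauss_window \<eta>) * exp (\<i> * complex_of_real (\<eta> \<bullet> (inverse \<delta> *\<^sub>R z)))"
  have m: "?f \<in> borel_measurable borel" by measurable
  have e: "?f (0 + ?c *\<^sub>R \<eta>) = complex_of_real (gauss_window (?c *\<^sub>R \<eta>)) * phase (\<eta> \<bullet> z)" for \<eta>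
  proof -
    have "(?c *\<^sub>R \<eta>) \<bullet> (inverse \<delta> *\<^sub>R z) = 2 * pi * (\<eta> \<bullet> z)" using assms by simp
    then show ?thesis unfolding phase_eq_exp add_0 by (simp only:) (simp add: mult_ac)
  qed
  have "(2 * pi) ^ DIM('a) * normal_kernel (inverse \<delta> *\<^sub>R z)
      = ?c ^ DIM('a) *\<^sub>R (\<integral>\<eta>. ?f (0 + ?c *\<^sub>R \<eta>) \<partial>lborel)"
    using assms integral_lborel_affine[OF m, of ?c 0] integral_gauss_window[of "inverse \<delta> *\<^sub>R z"]
    by simp
  then have *: "(2 * pi) ^ DIM('a) * normal_kernel (inverse \<delta> *\<^sub>R z)
      = (2 * pi) ^ DIM('a) * \<delta> ^ DIM('a)
        * (\<integral>\<eta>. complex_of_real (gauss_window (?c *\<^sub>R \<eta>)) * phase (\<eta> \<bullet> z) \<partial>lborel)"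
    unfolding e by (simp add: scaleR_conv_of_real power_mult_distrib mult_ac)
  have "normal_kernel (inverse \<delta> *\<^sub>R z)
      = \<delta> ^ DIM('a) * (\<integral>\<eta>. complex_of_real (gauss_window (?c *\<^sub>R \<eta>)) * phase (\<eta> \<bullet> z) \<partial>lborel)"
  proof -
    have "complex_of_real ((2 * pi) ^ DIM('a)) \<noteq> 0" by simp
    then show ?thesis using * unfolding mult.assoc by (simp del: of_real_power)
  qed
  then show ?thesis using assms by (simp add: field_simps)
qed

text \<open>
Gaussian summation: inserting the window \<open>\<eta> \<mapsto> gauss_window (2 \<pi> \<delta> \<eta>)\<close> into the inversion integral and
exchanging the integrals turns it into the average of \<open>F\<close> over a normal distribution of width \<open>\<delta>\<close>
around \<open>y\<close>. As \<open>\<delta>\<close> tends to \<open>0\<close>, the window tends to \<open>1\<close> and the average tends to \<open>F y\<close>.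
\<close>

theorem fourier_inversion:
  fixes F :: "'a::euclidean_space \<Rightarrow> complex"
  assumes cont: "continuous_on UNIV F" and int: "integrable lborel F"
    and bound: "\<And>x. norm (F x) \<le> B" and fint: "integrable lborel (fourier F)"
  shows "(\<integral>\<eta>. phase (\<eta> \<bullet> y) * fourier F \<eta> \<partial>lborel) = F y"
proof -
  have [measurable]: "F \<in> borel_measurable borel" "fourier F \<in> borel_measurable borel"
    using int fint by simp_all
  define \<delta> where "\<delta> n = inverse (real (Suc n))" for n
  have \<delta>_pos: "\<delta> n > 0" for n by (simp add: \<delta>_def)
  have \<delta>_lim: "\<delta> \<longlonglongrightarrow> 0" unfolding \<delta>_def by (rule LIMSEQ_inverse_real_of_nat)
  \<comment> \<open>The inversion integral with the frequency cut-off at scale \<open>1 / \<delta> n\<close>.\<close>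
  define I where "I n = (\<integral>\<eta>. phase (\<eta> \<bullet> y) * fourier F \<eta>
    * complex_of_real (gauss_window ((2 * pi * \<delta> n) *\<^sub>R \<eta>)) \<partial>lborel)" for n
  have limI: "I \<longlonglongrightarrow> (\<integral>\<eta>. phase (\<eta> \<bullet> y) * fourier F \<eta> \<partial>lborel)"
    unfolding I_def
  proof (rule integral_dominated_convergence)
    show "integrable lborel (\<lambda>\<eta>. norm (fourier F \<eta>))" using fint by simp
    show "AE \<eta> in lborel. (\<lambda>n. phase (\<eta> \<bullet> y) * fourier F \<eta>
        * complex_of_real (gauss_window ((2 * pi * \<delta> n) *\<^sub>R \<eta>))) \<longlonglongrightarrow> phase (\<eta> \<bullet> y) * fourier F \<eta>"
    proof (rule AE_I2)
      fix \<eta> :: 'a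
      have "(\<lambda>n. gauss_window ((2 * pi * \<delta> n) *\<^sub>R \<eta>)) \<longlonglongrightarrow> exp (- (((2 * pi * 0) *\<^sub>R \<eta>) \<bullet> ((2 * pi * 0) *\<^sub>R \<eta>)) / 2)"
        unfolding gauss_window_def by (intro tendsto_intros \<delta>_lim) auto
      then have "(\<lambda>n. complex_of_real (gauss_window ((2 * pi * \<delta> n) *\<^sub>R \<eta>))) \<longlonglongrightarrow> complex_of_real 1"
        by (intro tendsto_of_real) simp
      then show "(\<lambda>n. phase (\<eta> \<bullet> y) * fourier F \<eta>
        * complex_of_real (gauss_window ((2 * pi * \<delta> n) *\<^sub>R \<eta>))) \<longlonglongrightarrow> phase (\<eta> \<bullet> y) * fourier F \<eta>"
        using tendsto_mult_left by fastforce
    qed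
    show "AE \<eta> in lborel. norm (phase (\<eta> \<bullet> y) * fourier F \<eta>
        * complex_of_real (gauss_window ((2 * pi * \<delta> n) *\<^sub>R \<eta>))) \<le> norm (fourier F \<eta>)" for n
      by (simp add: norm_mult gauss_window_le_1 mult_left_le)
  qed measurable
  have "I n = (\<integral>u. F (y - \<delta> n *\<^sub>R u) * complex_of_real (normal_kernel u) \<partial>lborel)" for n
  proof -
    let ?K = "\<lambda>\<eta>::'a. complex_of_real (gauss_window ((2 * pi * \<delta> n) *\<^sub>R \<eta>))"
    have K: "integrable lborel ?K"
      using \<delta>_pos[of n] integrable_lborel_affine[of "gauss_window :: 'a \<Rightarrow> real" "2 * pi * \<delta> n" 0]
      by (simp add: integrable_gauss_window)
    have [measurable]: "?K \<in> borel_measurable borel" by measurable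
    have "integrable (lborel \<Otimes>\<^sub>M lborel) (\<lambda>(\<eta>, s). ?K \<eta> * F s)"
      by (intro integrable_times_pair K int)
    then have i: "integrable (lborel \<Otimes>\<^sub>M lborel) (\<lambda>(\<eta>, s). phase (\<eta> \<bullet> (y - s)) * (?K \<eta> * F s))"
      by (rule Bochner_Integration.integrable_bound) (auto simp: norm_mult)
    have "I n = (\<integral>\<eta>. \<integral>s. phase (\<eta> \<bullet> (y - s)) * (?K \<eta> * F s) \<partial>lborel \<partial>lborel)"
    proof -
      have "phase (\<eta> \<bullet> y) * fourier F \<eta> * ?K \<eta> = (\<integral>s. phase (\<eta> \<bullet> (y - s)) * (?K \<eta> * F s) \<partial>lborel)" for \<eta>
      proof -
        have "phase (\<eta> \<bullet> (y - s)) * (?K \<eta> * F s)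
            = (phase (\<eta> \<bullet> y) * ?K \<eta>) * (phase (- (s \<bullet> \<eta>)) * F s)" for s
        proof -
          have "\<eta> \<bullet> (y - s) = \<eta> \<bullet> y + - (s \<bullet> \<eta>)" by (simp add: inner_diff_right inner_commute)
          then show ?thesis by (simp only: phase_add mult_ac)
        qed
        then have "(\<integral>s. phase (\<eta> \<bullet> (y - s)) * (?K \<eta> * F s) \<partial>lborel)
            = (phase (\<eta> \<bullet> y) * ?K \<eta>) * (\<integral>s. phase (- (s \<bullet> \<eta>)) * F s \<partial>lborel)"
          by (simp only: integral_mult_right_zero)
        then show ?thesis unfolding fourier_phase by (simp only: mult_ac)
      qed
      then show ?thesis unfolding I_def by presburger
    qed
    also have "\<dots> = (\<integral>s. \<integral>\<eta>. phase (\<eta> \<bullet> (y - s)) * (?K \<eta> * F s) \<partial>lborel \<partial>lborel)"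
      by (rule lborel_pair.Fubini_integral[OF i, symmetric])
    also have "\<dots> = (\<integral>s. F s * complex_of_real (inverse (\<delta> n) ^ DIM('a)
        * normal_kernel (inverse (\<delta> n) *\<^sub>R (y - s))) \<partial>lborel)"
    proof (rule Bochner_Integration.integral_cong[OF refl])
      fix s
      have "(\<integral>\<eta>. phase (\<eta> \<bullet> (y - s)) * (?K \<eta> * F s) \<partial>lborel)
          = (\<integral>\<eta>. F s * (?K \<eta> * phase (\<eta> \<bullet> (y - s))) \<partial>lborel)"
        by (simp add: mult_ac)
      also have "\<dots> = F s * (\<integral>\<eta>. ?K \<eta> * phase (\<eta> \<bullet> (y - s)) \<partial>lborel)"
        by (rule integral_mult_right_zero)
      finally show "(\<integral>\<eta>. phase (\<eta> \<bullet> (y - s)) * (?K \<eta> * F s) \<partial>lborel) = F s *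
          complex_of_real (inverse (\<delta> n) ^ DIM('a) * normal_kernel (inverse (\<delta> n) *\<^sub>R (y - s)))"
        unfolding integral_scaled_gauss_window[OF \<delta>_pos] .
    qed
    \<comment> \<open>Substitute \<open>s = y - \<delta> u\<close>; the Jacobian cancels the factor \<open>\<delta>\<close> to the power \<open>- DIM('a)\<close>.\<close>
    also have "\<dots> = \<bar>- \<delta> n\<bar> ^ DIM('a) *\<^sub>R (\<integral>u. F (y + (- \<delta> n) *\<^sub>R u) * complex_of_real (inverse (\<delta> n) ^ DIM('a)
        * normal_kernel (inverse (\<delta> n) *\<^sub>R (y - (y + (- \<delta> n) *\<^sub>R u)))) \<partial>lborel)"
      using \<delta>_pos[of n] by (intro integral_lborel_affine) auto
    also have "\<dots> = (\<integral>u. F (y - \<delta> n *\<^sub>R u) * complex_of_real (normal_kernel u) \<partial>lborel)"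
      unfolding integral_scaleR_right[symmetric]
      using \<delta>_pos[of n]
      by (intro Bochner_Integration.integral_cong refl)
         (simp add: scaleR_conv_of_real field_simps)
    finally show ?thesis .
  qed
  then have I_eq: "I = (\<lambda>n. \<integral>u. F (y - \<delta> n *\<^sub>R u) * complex_of_real (normal_kernel u) \<partial>lborel)"
    by blast
  have "(\<lambda>n. \<integral>u. F (y - \<delta> n *\<^sub>R u) * complex_of_real (normal_kernel u) \<partial>lborel)
      \<longlonglongrightarrow> (\<integral>u. F y * complex_of_real (normal_kernel (u::'a)) \<partial>lborel)"
  proof (rule integral_dominated_convergence)
    show "integrable lborel (\<lambda>u. B * normal_kernel u)"
      by (intro integrable_mult_right integrable_normal_kernel)
    show "AE u in lborel. (\<lambda>n. F (y - \<delta> n *\<^sub>R u) * complex_of_real (normal_kernel u))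
        \<longlonglongrightarrow> F y * complex_of_real (normal_kernel u)"
    proof (rule AE_I2)
      fix u :: 'a
      have "(\<lambda>n. y - \<delta> n *\<^sub>R u) \<longlonglongrightarrow> y - 0 *\<^sub>R u" by (intro tendsto_intros \<delta>_lim)
      moreover have "isCont F y" using cont by (simp add: continuous_on_eq_continuous_at)
      ultimately have "(\<lambda>n. F (y - \<delta> n *\<^sub>R u)) \<longlonglongrightarrow> F y"
        using isCont_tendsto_compose[of y F "\<lambda>n. y - \<delta> n *\<^sub>R u"] by simp
      then show "(\<lambda>n. F (y - \<delta> n *\<^sub>R u) * complex_of_real (normal_kernel u))
        \<longlonglongrightarrow> F y * complex_of_real (normal_kernel u)" by (rule tendsto_mult_right)
    qed
    show "AE u in lborel. norm (F (y - \<delta> n *\<^sub>R u) * complex_of_real (normal_kernel u))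
        \<le> B * normal_kernel u" for n
      by (auto simp: norm_mult normal_kernel_nonneg intro!: mult_right_mono bound)
  qed measurable
  then have "I \<longlonglongrightarrow> (\<integral>u. F y * complex_of_real (normal_kernel (u::'a)) \<partial>lborel)"
    unfolding I_eq .
  moreover have "(\<integral>u. F y * complex_of_real (normal_kernel (u::'a)) \<partial>lborel) = F y"
    by (simp add: integral_normal_kernel)
  ultimately show ?thesis using LIMSEQ_unique[OF limI] by simp
qed

text \<open>
Inversion applies to the difference of the two functions: its Fourier transform is zero and thus
integrable, even if neither transform is known to be integrable.
\<close>

lemma fourier_injective:
  fixes F G :: "'a::euclidean_space \<Rightarrow> complex"
  assumes F: "continuous_on UNIV F" "rapidly_decreasing F"
    and G: "continuous_on UNIV G" "rapidly_decreasing G"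
    and eq: "\<And>\<omega>. fourier F \<omega> = fourier G \<omega>"
  shows "F y = G y"
proof -
  let ?D = "\<lambda>y. F y + (-1) * G y"
  have Fi: "integrable lborel F" and Gi: "integrable lborel G"
    using F G by (auto intro: rapidly_decreasing_integrable borel_measurable_continuous_onI)
  have D: "rapidly_decreasing ?D"
    by (intro rapidly_decreasing_add F rapidly_decreasing_mult_bounded[where B = 1] G) simp
  have c: "continuous_on UNIV ?D" by (intro continuous_intros F G)
  obtain B where B: "\<And>y. norm (?D y) \<le> B" using rapidly_decreasing_bounded[OF D] by blast
  have i: "integrable lborel ?D" using Fi Gi by simp
  have "fourier ?D \<omega> = fourier F \<omega> - fourier G \<omega>" for \<omega>
  proof -
    have "integrable lborel (\<lambda>x. phase (- (x \<bullet> \<omega>)) * H x)" if "integrable lborel H" for H :: "'a \<Rightarrow> complex"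
      by (intro integrable_phase_mult that) measurable
    then show ?thesis unfolding fourier_phase using Fi Gi by (simp add: right_diff_distrib)
  qed
  then have z: "fourier ?D = (\<lambda>_. 0)" by (simp add: fun_eq_iff eq)
  have "integrable lborel (fourier ?D)" unfolding z by simp
  from fourier_inversion[OF c i B this, of y] show ?thesis unfolding z by simp
qed

text \<open>
The convolution theorem in the direction that needs inversion. Writing \<open>fourier G (\<omega> - \<eta>)\<close> as an
integral over \<open>y\<close> and integrating over \<open>\<eta>\<close> first leaves the inversion integral of \<open>F\<close> at \<open>y\<close>.
\<close>

lemma conv_fourier:
  fixes F G :: "'a::euclidean_space \<Rightarrow> complex"
  assumes F: "continuous_on UNIV F" "integrable lborel F" "\<And>x. norm (F x) \<le> B"
      "integrable lborel (fourier F)"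
    and G: "integrable lborel G"
  shows "conv (fourier F) (fourier G) \<omega> = fourier (\<lambda>y. F y * G y) \<omega>"
proof -
  have Fm: "fourier F \<in> borel_measurable borel" using F(4) by simp
  have Gm: "G \<in> borel_measurable borel" using G by simp
  note [measurable] = Fm Gm
  have "integrable (lborel \<Otimes>\<^sub>M lborel) (\<lambda>(\<eta>, y). fourier F \<eta> * G y)"
    by (rule integrable_times_pair[OF F(4) G])
  then have i: "integrable (lborel \<Otimes>\<^sub>M lborel)
      (\<lambda>(\<eta>, y). phase (- (y \<bullet> (\<omega> - \<eta>))) * (fourier F \<eta> * G y))"
    by (rule Bochner_Integration.integrable_bound) (auto simp: norm_mult)
  have "conv (fourier F) (fourier G) \<omega>
      = (\<integral>\<eta>. \<integral>y. phase (- (y \<bullet> (\<omega> - \<eta>))) * (fourier F \<eta> * G y) \<partial>lborel \<partial>lborel)"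
  proof -
    have "fourier F \<eta> * fourier G (\<omega> - \<eta>)
        = (\<integral>y. phase (- (y \<bullet> (\<omega> - \<eta>))) * (fourier F \<eta> * G y) \<partial>lborel)" for \<eta>
      unfolding fourier_phase[of G] integral_mult_right_zero[symmetric] by (simp only: mult_ac)
    then show ?thesis unfolding conv_def by presburger
  qed
  also have "\<dots> = (\<integral>y. \<integral>\<eta>. phase (- (y \<bullet> (\<omega> - \<eta>))) * (fourier F \<eta> * G y) \<partial>lborel \<partial>lborel)"
    by (rule lborel_pair.Fubini_integral[OF i, symmetric])
  also have "\<dots> = (\<integral>y. phase (- (y \<bullet> \<omega>)) * (F y * G y) \<partial>lborel)"
  proof (rule Bochner_Integration.integral_cong[OF refl])
    fix y
    have "phase (- (y \<bullet> (\<omega> - \<eta>))) * (fourier F \<eta> * G y)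
        = (phase (- (y \<bullet> \<omega>)) * G y) * (phase (\<eta> \<bullet> y) * fourier F \<eta>)" for \<eta>
    proof -
      have "- (y \<bullet> (\<omega> - \<eta>)) = - (y \<bullet> \<omega>) + \<eta> \<bullet> y" by (simp add: inner_diff_right inner_commute)
      then show ?thesis by (simp only: phase_add mult_ac)
    qed
    then have "(\<integral>\<eta>. phase (- (y \<bullet> (\<omega> - \<eta>))) * (fourier F \<eta> * G y) \<partial>lborel)
        = (phase (- (y \<bullet> \<omega>)) * G y) * (\<integral>\<eta>. phase (\<eta> \<bullet> y) * fourier F \<eta> \<partial>lborel)"
      by (simp only: integral_mult_right_zero)
    then show "(\<integral>\<eta>. phase (- (y \<bullet> (\<omega> - \<eta>))) * (fourier F \<eta> * G y) \<partial>lborel)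
        = phase (- (y \<bullet> \<omega>)) * (F y * G y)"
      unfolding fourier_inversion[OF F] by (simp only: mult_ac)
  qed
  finally show ?thesis unfolding fourier_phase .
qed

lemma cnj_fourier: "cnj (fourier G \<eta>) = fourier (\<lambda>y. cnj (G y)) (- \<eta>)"
proof -
  have "cnj (fourier G \<eta>) = (\<integral>x. cnj (phase (- (x \<bullet> \<eta>)) * G x) \<partial>lborel)"
    unfolding fourier_phase by (rule Bochner_Integration.integral_cnj[symmetric])
  then show ?thesis unfolding fourier_phase by (simp add: cnj_phase)
qed

text \<open>
The convolution theorem for \<open>F\<close> and \<open>cnj G\<close> at frequency \<open>0\<close>.
\<close>

lemma parseval:
  fixes F G :: "'a::euclidean_space \<Rightarrow> complex"
  assumes F: "continuous_on UNIV F" "integrable lborel F" "\<And>x. norm (F x) \<le> B"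
      "integrable lborel (fourier F)"
    and G: "integrable lborel G"
  shows "(\<integral>\<eta>. fourier F \<eta> * cnj (fourier G \<eta>) \<partial>lborel) = (\<integral>y. F y * cnj (G y) \<partial>lborel)"
proof -
  have "integrable lborel (\<lambda>y. cnj (G y))" using G by simp
  from conv_fourier[OF F this, of 0] show ?thesis
    unfolding conv_def cnj_fourier by (simp add: fourier_phase[of _ 0])
qed

section \<open>Wigner distributions with a linear parameter\<close>

text \<open>
The pullback of the tensor product of \<open>u\<close> and \<open>cnj v\<close> under \<open>(x,y) \<mapsto> (x + T y, x + T y - y)\<close>.
\<close>

definition twist :: "('a \<Rightarrow> 'a) \<Rightarrow> ('a::euclidean_space \<Rightarrow> complex) \<Rightarrow> ('a \<Rightarrow> complex) \<Rightarrow> 'a \<Rightarrow> 'a \<Rightarrow> complex" where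
  "twist T u v x y = u (x + T y) * cnj (v (x + T y - y))"

text \<open>
For \<open>T = \<tau> I\<close> this is the \<open>\<tau>\<close>-Wigner distribution, and for \<open>\<tau> = 1/2\<close> the Wigner distribution itself.
\<close>

definition tau_wigner :: "('a \<Rightarrow> 'a) \<Rightarrow> ('a::euclidean_space \<Rightarrow> complex) \<Rightarrow> ('a \<Rightarrow> complex) \<Rightarrow> 'a \<Rightarrow> 'a \<Rightarrow> complex" where
  "tau_wigner T u v x = fourier (twist T u v x)"

lemma twist_measurable_pair:
  fixes T :: "'a::euclidean_space \<Rightarrow> 'a"
  assumes "linear T" "schwartz u" "schwartz v"
  shows "(\<lambda>(x, y). twist T u v x y) \<in> borel_measurable (borel \<Otimes>\<^sub>M borel)"
proof -
  note [measurable] = linear_measurable[OF assms(1)] assms(2,3)[THEN schwartz_measurable]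
  show ?thesis unfolding twist_def by measurable
qed

lemma twist_measurable:
  fixes T :: "'a::euclidean_space \<Rightarrow> 'a"
  assumes "linear T" "schwartz u" "schwartz v"
  shows "twist T u v x \<in> borel_measurable borel"
proof -
  note [measurable] = linear_measurable[OF assms(1)] assms(2,3)[THEN schwartz_measurable]
  show ?thesis unfolding twist_def[abs_def] by measurable
qed

lemma twist_continuous:
  assumes "linear T" "schwartz u" "schwartz v"
  shows "continuous_on UNIV (twist T u v x)"
proof -
  have T: "continuous_on UNIV T"
    using assms(1) by (simp add: linear_continuous_on linear_conv_bounded_linear)
  have c: "continuous_on UNIV (\<lambda>y. w (g y))" if "schwartz w" "continuous_on UNIV g"
    for w and g :: "'a \<Rightarrow> 'a"
    using continuous_on_compose[OF that(2) schwartz_continuous_on[OF that(1)]] by (simp add: o_def)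
  show ?thesis
    unfolding twist_def[abs_def] by (intro continuous_intros c assms T)
qed

text \<open>
With \<open>p = x + T y\<close> and \<open>q = p - y\<close>, both \<open>y = p - q\<close> and \<open>x = p - T y\<close> are linear in \<open>(p,q)\<close>. Hence
each of \<open>1 + norm x\<close> and \<open>1 + norm y\<close> is at most a constant times \<open>(1 + norm p) (1 + norm q)\<close>, and the
weights are absorbed by the decay of \<open>u\<close> at \<open>p\<close> and of \<open>v\<close> at \<open>q\<close>.
\<close>

lemma twist_bound:
  fixes T :: "'a::euclidean_space \<Rightarrow> 'a"
  assumes "linear T" "schwartz u" "schwartz v"
  shows "\<exists>C. \<forall>x y. (1 + norm x) ^ k * (1 + norm y) ^ k * norm (twist T u v x y) \<le> C"
proof -
  obtain Cu Cv where Cu: "\<And>x. (1 + norm x) ^ (2 * k) * norm (u x) \<le> Cu"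
    and Cv: "\<And>x. (1 + norm x) ^ (2 * k) * norm (v x) \<le> Cv"
    using assms(2,3)[THEN schwartz_rapidly_decreasing] unfolding rapidly_decreasing_def by meson
  obtain B where B: "B > 0" "\<And>y. norm (T y) \<le> B * norm y"
    using linear_bounded_pos[OF assms(1)] by blast
  have "(1 + norm x) ^ k * (1 + norm y) ^ k * norm (twist T u v x y) \<le> (1 + B) ^ k * (Cu * Cv)" for x y
  proof -
    define p where "p = x + T y"
    define q where "q = p - y"
    define w where "w = (1 + norm p) * (1 + norm q)"
    have w1: "1 + norm p + norm q \<le> w" unfolding w_def ring_distribs by simp
    have y: "norm y \<le> norm p + norm q"
      using norm_triangle_ineq4[of p q] by (simp add: p_def q_def)
    have "norm x \<le> norm p + norm (T y)"
      using norm_triangle_ineq4[of p "T y"] by (simp add: p_def)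
    also have "\<dots> \<le> norm p + B * (norm p + norm q)"
      using B(2)[of y] mult_left_mono[OF y, of B] B(1) by linarith
    also have "1 + \<dots> \<le> (1 + B) * (1 + norm p + norm q)"
      using B(1) unfolding ring_distribs by simp
    also have "\<dots> \<le> (1 + B) * w" using w1 B(1) by (intro mult_left_mono) auto
    finally have x: "1 + norm x \<le> (1 + B) * w" by simp
    have "0 \<le> (1 + B) * w" by (rule order_trans[OF _ x]) simp
    moreover have "1 + norm y \<le> w" using y w1 by linarith
    ultimately have "(1 + norm x) * (1 + norm y) \<le> ((1 + B) * w) * w"
      using mult_mono[OF x, of "1 + norm y" w] by simp
    then have "((1 + norm x) * (1 + norm y)) ^ k \<le> ((1 + B) * w\<^sup>2) ^ k"
      by (intro power_mono) (auto simp: power2_eq_square mult_ac)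
    then have "((1 + norm x) * (1 + norm y)) ^ k * norm (twist T u v x y)
        \<le> ((1 + B) * w\<^sup>2) ^ k * norm (twist T u v x y)" by (rule mult_right_mono) simp
    also have "\<dots> = (1 + B) ^ k * (((1 + norm p) ^ (2 * k) * norm (u p)) * ((1 + norm q) ^ (2 * k) * norm (v q)))"
    proof -
      have "((1 + B) * w\<^sup>2) ^ k = (1 + B) ^ k * ((1 + norm p) ^ (2 * k) * (1 + norm q) ^ (2 * k))"
        by (simp only: w_def power_mult_distrib power_mult[of _ 2 k])
      moreover have "norm (twist T u v x y) = norm (u p) * norm (v q)"
        unfolding twist_def p_def q_def by (simp add: norm_mult)
      ultimately show ?thesis by (simp only: mult_ac)
    qed
    also have "\<dots> \<le> (1 + B) ^ k * (Cu * Cv)"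
      using B(1) by (intro mult_left_mono mult_mono Cu Cv order_trans[OF _ Cu[of p]]) auto
    finally show ?thesis by (simp add: power_mult_distrib)
  qed
  then show ?thesis by blast
qed

lemma twist_bound_uniform:
  fixes T :: "'a::euclidean_space \<Rightarrow> 'a"
  assumes "linear T" "schwartz u" "schwartz v"
  shows "\<exists>C. \<forall>x y. (1 + norm y) ^ k * norm (twist T u v x y) \<le> C"
proof -
  obtain C where C: "\<And>x y. (1 + norm x) ^ k * (1 + norm y) ^ k * norm (twist T u v x y) \<le> C"
    using twist_bound[OF assms, of k] by blast
  have "(1 + norm y) ^ k * norm (twist T u v x y) \<le> C" for x y
  proof -
    have "1 * ((1 + norm y) ^ k * norm (twist T u v x y))
        \<le> (1 + norm x) ^ k * ((1 + norm y) ^ k * norm (twist T u v x y))"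
      by (intro mult_right_mono one_le_power) auto
    then show ?thesis using C[of x y] by (simp add: mult_ac)
  qed
  then show ?thesis by blast
qed

lemma twist_rapidly_decreasing:
  fixes T :: "'a::euclidean_space \<Rightarrow> 'a"
  assumes "linear T" "schwartz u" "schwartz v"
  shows "rapidly_decreasing (twist T u v x)"
  unfolding rapidly_decreasing_def using twist_bound_uniform[OF assms] by blast

lemma twist_integrable:
  fixes T :: "'a::euclidean_space \<Rightarrow> 'a"
  assumes "linear T" "schwartz u" "schwartz v"
  shows "integrable lborel (twist T u v x)"
  using assms by (intro rapidly_decreasing_integrable twist_rapidly_decreasing twist_measurable)

lemma twist_bounded:
  assumes "linear T" "schwartz f" "schwartz g"
  obtains B where "\<And>y. norm (twist T f g x y) \<le> B"
  using rapidly_decreasing_bounded[OF twist_rapidly_decreasing[OF assms]] by blast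

lemma twist_has_derivative:
  fixes T :: "'a::euclidean_space \<Rightarrow> 'a"
  assumes T: "linear T" and u: "schwartz u" and v: "schwartz v"
  shows "(twist T u v x has_derivative
    (\<lambda>e. twist T u (\<lambda>z. frechet_derivative v (at z) (T e - e)) x y
       + twist T (\<lambda>z. frechet_derivative u (at z) (T e)) v x y)) (at y)"
proof -
  have bl: "bounded_linear T" using T by (simp add: linear_conv_bounded_linear)
  have p: "((\<lambda>y. x + T y) has_derivative (\<lambda>e. T e)) (at y)"
    by (auto intro!: derivative_eq_intros bounded_linear.has_derivative[OF bl])
  have q: "((\<lambda>y. x + T y - y) has_derivative (\<lambda>e. T e - e)) (at y)"
    by (auto intro!: derivative_eq_intros bounded_linear.has_derivative[OF bl])
  have c: "((\<lambda>y. cnj (v (x + T y - y))) has_derivative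
      (\<lambda>e. cnj (frechet_derivative v (at (x + T y - y)) (T e - e)))) (at y)"
    by (rule bounded_linear.has_derivative[OF bounded_linear_cnj])
       (rule has_derivative_compose[OF q schwartz_has_derivative[OF v]])
  show ?thesis
    unfolding twist_def[abs_def]
    by (rule has_derivative_mult[OF has_derivative_compose[OF p schwartz_has_derivative[OF u]] c])
qed

lemma phase_has_derivative:
  fixes y :: "'a::euclidean_space"
  shows "((\<lambda>y. phase (- (y \<bullet> \<omega>))) has_derivative
    (\<lambda>e. phase (- (y \<bullet> \<omega>)) * (- (2 * pi * \<i>) * complex_of_real (e \<bullet> \<omega>)))) (at y)"
proof -
  have "((\<lambda>y. - (2 * pi * \<i>) * complex_of_real (y \<bullet> \<omega>)) has_derivative
      (\<lambda>e. - (2 * pi * \<i>) * complex_of_real (e \<bullet> \<omega>))) (at y)"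
    by (auto intro!: derivative_eq_intros)
  from has_derivative_compose[OF this DERIV_exp[unfolded has_field_derivative_def]]
  moreover have "phase (- (y \<bullet> \<omega>)) = exp (- (2 * pi * \<i>) * complex_of_real (y \<bullet> \<omega>))" for y
    unfolding phase_eq_exp by simp
  ultimately show ?thesis by (simp only:)
qed

text \<open>
Integration by parts in \<open>y\<close>. By the product rule for \<open>twist\<close>, the two terms on the right are
distributions of the same kind with one argument differentiated.
\<close>

lemma tau_wigner_derivative_rule:
  fixes T :: "'a::euclidean_space \<Rightarrow> 'a"
  assumes T: "linear T" and u: "schwartz u" and v: "schwartz v" and b: "b \<in> Basis"
  shows "(2 * pi * \<i>) * complex_of_real (\<omega> \<bullet> b) * tau_wigner T u v x \<omega>
    = tau_wigner T (\<lambda>z. frechet_derivative u (at z) (T b)) v x \<omega>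
      + tau_wigner T u (\<lambda>z. frechet_derivative v (at z) (T b - b)) x \<omega>"
proof -
  let ?u' = "\<lambda>z. frechet_derivative u (at z) (T b)"
  let ?v' = "\<lambda>z. frechet_derivative v (at z) (T b - b)"
  have u': "schwartz ?u'" and v': "schwartz ?v'"
    by (rule schwartz_directional_derivative[OF u], rule schwartz_directional_derivative[OF v])
  let ?e = "\<lambda>y. phase (- (y \<bullet> \<omega>))"
  let ?d = "\<lambda>y. ?e y * (twist T u ?v' x y + twist T ?u' v x y)
      + ?e y * (- (2 * pi * \<i>) * complex_of_real (b \<bullet> \<omega>)) * twist T u v x y"
  note tw = T u v u' v' twist_integrable twist_rapidly_decreasing
  note [measurable] = twist_measurable[OF T u v] twist_measurable[OF T u' v] twist_measurable[OF T u v']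
  let ?D = "\<lambda>y e. ?e y * (twist T u (\<lambda>z. frechet_derivative v (at z) (T e - e)) x y
             + twist T (\<lambda>z. frechet_derivative u (at z) (T e)) v x y)
        + ?e y * (- (2 * pi * \<i>) * complex_of_real (e \<bullet> \<omega>)) * twist T u v x y"
  have "(\<integral>y. ?D y b \<partial>lborel) = 0"
  proof (rule integral_directional_derivative_eq_0[where h = "\<lambda>y. ?e y * twist T u v x y"
        and h' = ?D and b = b])
    show "((\<lambda>y. ?e y * twist T u v x y) has_derivative ?D y) (at y)" for y
      by (rule has_derivative_mult[OF phase_has_derivative twist_has_derivative[OF T u v]])
    show "rapidly_decreasing (\<lambda>y. ?e y * twist T u v x y)"
      using tw by (intro rapidly_decreasing_mult_bounded[where B = 1]) auto
    have "rapidly_decreasing (\<lambda>y. (?e y * (- (2 * pi * \<i>) * complex_of_real (b \<bullet> \<omega>))) * twist T u v x y)"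
      using tw by (intro rapidly_decreasing_mult_bounded[where B = "norm (2 * pi * \<i> * (b \<bullet> \<omega>))"])
        (auto simp: norm_mult)
    moreover have "rapidly_decreasing (\<lambda>y. ?e y * (twist T u ?v' x y + twist T ?u' v x y))"
      using tw by (intro rapidly_decreasing_mult_bounded[where B = 1] rapidly_decreasing_add) auto
    ultimately show "rapidly_decreasing ?d" by (rule rapidly_decreasing_add[rotated])
    show "?d \<in> borel_measurable borel" by measurable
    show "norm b = 1" using b by simp
  qed
  moreover have "(\<integral>y. ?d y \<partial>lborel) = (tau_wigner T ?u' v x \<omega> + tau_wigner T u ?v' x \<omega>)
      + (- (2 * pi * \<i>) * complex_of_real (\<omega> \<bullet> b)) * tau_wigner T u v x \<omega>"
  proof -
    have i: "integrable lborel (\<lambda>y. ?e y * twist T f g x y)" if "schwartz f" "schwartz g" for f g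
      by (intro integrable_phase_mult twist_integrable T that) measurable
    have "?d y = (?e y * twist T ?u' v x y + ?e y * twist T u ?v' x y)
        + (- (2 * pi * \<i>) * complex_of_real (\<omega> \<bullet> b)) * (?e y * twist T u v x y)" for y
      by (simp add: algebra_simps inner_commute)
    then have "(\<integral>y. ?d y \<partial>lborel) = (\<integral>y. (?e y * twist T ?u' v x y + ?e y * twist T u ?v' x y)
        + (- (2 * pi * \<i>) * complex_of_real (\<omega> \<bullet> b)) * (?e y * twist T u v x y) \<partial>lborel)" by presburger
    also have "\<dots> = ((\<integral>y. ?e y * twist T ?u' v x y \<partial>lborel) + (\<integral>y. ?e y * twist T u ?v' x y \<partial>lborel))
        + (- (2 * pi * \<i>) * complex_of_real (\<omega> \<bullet> b)) * (\<integral>y. ?e y * twist T u v x y \<partial>lborel)"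
      unfolding integral_mult_right_zero[symmetric]
      by (intro Bochner_Integration.integral_add[THEN trans] arg_cong2[where f = "(+)"] refl
          Bochner_Integration.integrable_add integrable_mult_right i u v u' v')
    finally show ?thesis unfolding tau_wigner_def fourier_phase .
  qed
  ultimately show ?thesis by (simp add: algebra_simps add_eq_0_iff)
qed

lemma tau_wigner_bound:
  fixes T :: "'a::euclidean_space \<Rightarrow> 'a"
  assumes "linear T" "schwartz u" "schwartz v"
  shows "\<exists>C. \<forall>x \<omega>. (1 + norm x) ^ k * norm (tau_wigner T u v x \<omega>) \<le> C"
proof -
  let ?d = "2 * DIM('a)"
  \<comment> \<open>Enough decay for the weight in \<open>x\<close> and for integrability in \<open>y\<close>.\<close>
  define K where "K = max k ?d"
  obtain C where C: "\<And>x y. (1 + norm x) ^ K * (1 + norm y) ^ K * norm (twist T u v x y) \<le> C"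
    using twist_bound[OF assms, of K] by blast
  have "(1 + norm x) ^ k * norm (tau_wigner T u v x \<omega>)
      \<le> (\<integral>y. C * (1 / (1 + norm (y::'a)) ^ ?d) \<partial>lborel)" for x \<omega>
  proof -
    have "(1 + norm x) ^ k * norm (tau_wigner T u v x \<omega>)
        \<le> (1 + norm x) ^ k * (\<integral>y. norm (twist T u v x y) \<partial>lborel)"
      unfolding tau_wigner_def by (intro mult_left_mono norm_fourier_le) simp
    also have "\<dots> = (\<integral>y. (1 + norm x) ^ k * norm (twist T u v x y) \<partial>lborel)" by simp
    also have "\<dots> \<le> (\<integral>y. C * (1 / (1 + norm (y::'a)) ^ ?d) \<partial>lborel)"
    proof (rule integral_mono)
      fix y :: 'a
      have "(1 + norm x) ^ k * (1 + norm y) ^ ?d * norm (twist T u v x y)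
          \<le> (1 + norm x) ^ K * (1 + norm y) ^ K * norm (twist T u v x y)"
        by (intro mult_mono power_increasing) (auto simp: K_def)
      also have "\<dots> \<le> C" by (rule C)
      finally show "(1 + norm x) ^ k * norm (twist T u v x y) \<le> C * (1 / (1 + norm y) ^ ?d)"
        by (simp add: pos_le_divide_eq add_pos_nonneg mult_ac)
    qed (intro integrable_mult_right integrable_norm twist_integrable assms integrable_inverse_power_norm)+
    finally show ?thesis .
  qed
  then show ?thesis by blast
qed

text \<open>
Induction on the power of the coordinate. The functions \<open>u\<close> and \<open>v\<close> must stay arbitrary, since
the derivative rule replaces them by their derivatives.
\<close>

lemma tau_wigner_bound_frequency:
  fixes T :: "'a::euclidean_space \<Rightarrow> 'a"
  assumes T: "linear T" and b: "b \<in> Basis" and "schwartz u" "schwartz v"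
  shows "\<exists>C. \<forall>x \<omega>. (1 + norm x) ^ k * \<bar>\<omega> \<bullet> b\<bar> ^ n * norm (tau_wigner T u v x \<omega>) \<le> C"
  using assms(3,4)
proof (induction n arbitrary: u v)
  case 0
  then show ?case using tau_wigner_bound[OF T, of u v k] by simp
next
  case (Suc n)
  let ?u' = "\<lambda>z. frechet_derivative u (at z) (T b)"
  let ?v' = "\<lambda>z. frechet_derivative v (at z) (T b - b)"
  have u': "schwartz ?u'" and v': "schwartz ?v'"
    by (rule schwartz_directional_derivative[OF Suc.prems(1)],
        rule schwartz_directional_derivative[OF Suc.prems(2)])
  obtain C D where C: "\<And>x \<omega>. (1 + norm x) ^ k * \<bar>\<omega> \<bullet> b\<bar> ^ n * norm (tau_wigner T ?u' v x \<omega>) \<le> C"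
    and D: "\<And>x \<omega>. (1 + norm x) ^ k * \<bar>\<omega> \<bullet> b\<bar> ^ n * norm (tau_wigner T u ?v' x \<omega>) \<le> D"
    using Suc.IH[OF u' Suc.prems(2)] Suc.IH[OF Suc.prems(1) v'] by blast
  have "(1 + norm x) ^ k * \<bar>\<omega> \<bullet> b\<bar> ^ Suc n * norm (tau_wigner T u v x \<omega>) \<le> C + D" for x \<omega>
  proof -
    have "\<bar>\<omega> \<bullet> b\<bar> * norm (tau_wigner T u v x \<omega>)
        \<le> (2 * pi) * (\<bar>\<omega> \<bullet> b\<bar> * norm (tau_wigner T u v x \<omega>))"
      using mult_right_mono[of 1 "2 * pi" "\<bar>\<omega> \<bullet> b\<bar> * norm (tau_wigner T u v x \<omega>)"] pi_ge_two by simp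
    also have "\<dots> = norm ((2 * pi * \<i>) * complex_of_real (\<omega> \<bullet> b) * tau_wigner T u v x \<omega>)"
      by (simp add: norm_mult)
    also have "\<dots> \<le> norm (tau_wigner T ?u' v x \<omega>) + norm (tau_wigner T u ?v' x \<omega>)"
      unfolding tau_wigner_derivative_rule[OF T Suc.prems b] by (rule norm_triangle_ineq)
    finally have "((1 + norm x) ^ k * \<bar>\<omega> \<bullet> b\<bar> ^ n) * (\<bar>\<omega> \<bullet> b\<bar> * norm (tau_wigner T u v x \<omega>))
        \<le> ((1 + norm x) ^ k * \<bar>\<omega> \<bullet> b\<bar> ^ n) * (norm (tau_wigner T ?u' v x \<omega>) + norm (tau_wigner T u ?v' x \<omega>))"
      by (rule mult_left_mono) simp
    also have "\<dots> \<le> C + D" unfolding distrib_left by (intro add_mono C D)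
    finally show ?thesis by (simp add: mult_ac)
  qed
  then show ?case by blast
qed

lemma norm_power_le_coordinates:
  fixes \<omega> :: "'a::euclidean_space"
  shows "(1 + norm \<omega>) ^ k \<le> (1 + DIM('a)) ^ k * (1 + (\<Sum>b\<in>Basis. \<bar>\<omega> \<bullet> b\<bar> ^ k))"
proof -
  \<comment> \<open>Every summand of \<open>1 + (\<Sum>b\<in>Basis. \<bar>\<omega> \<bullet> b\<bar>)\<close> is at most \<open>m\<close>, and \<open>m\<close> is one of them.\<close>
  define m where "m = Max (insert 1 ((\<lambda>b. \<bar>\<omega> \<bullet> b\<bar>) ` Basis))"
  have m: "\<bar>\<omega> \<bullet> b\<bar> \<le> m" if "b \<in> Basis" for b
    unfolding m_def by (rule Max_ge) (use that in simp_all)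
  have m1: "1 \<le> m" unfolding m_def by (rule Max_ge) simp_all
  have "norm \<omega> \<le> (\<Sum>b\<in>Basis. \<bar>\<omega> \<bullet> b\<bar>)" by (rule norm_le_l1)
  also have "\<dots> \<le> DIM('a) * m" using m by (intro sum_bounded_above) auto
  finally have "1 + norm \<omega> \<le> (1 + DIM('a)) * m" using m1 by (simp add: distrib_right)
  then have "(1 + norm \<omega>) ^ k \<le> ((1 + DIM('a)) * m) ^ k" by (intro power_mono) auto
  also have "\<dots> = (1 + DIM('a)) ^ k * m ^ k" by (simp add: power_mult_distrib)
  also have "\<dots> \<le> (1 + DIM('a)) ^ k * (1 + (\<Sum>b\<in>Basis. \<bar>\<omega> \<bullet> b\<bar> ^ k))"
  proof (rule mult_left_mono)
    have "m \<in> insert 1 ((\<lambda>b. \<bar>\<omega> \<bullet> b\<bar>) ` Basis)" unfolding m_def by (intro Max_in) auto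
    then consider "m = 1" | b where "b \<in> Basis" "m = \<bar>\<omega> \<bullet> b\<bar>" by blast
    then show "m ^ k \<le> 1 + (\<Sum>b\<in>Basis. \<bar>\<omega> \<bullet> b\<bar> ^ k)"
    proof cases
      case 1
      then show ?thesis by (simp add: sum_nonneg)
    next
      case (2 b)
      then have "m ^ k \<le> (\<Sum>b\<in>Basis. \<bar>\<omega> \<bullet> b\<bar> ^ k)"
        by (auto intro!: member_le_sum[of b Basis "\<lambda>b. \<bar>\<omega> \<bullet> b\<bar> ^ k"])
      then show ?thesis by simp
    qed
  qed simp
  finally show ?thesis .
qed

lemma tau_wigner_decay:
  fixes T :: "'a::euclidean_space \<Rightarrow> 'a"
  assumes "linear T" "schwartz u" "schwartz v"
  shows "\<exists>C\<ge>0. \<forall>x \<omega>. norm (tau_wigner T u v x \<omega>) \<le> C * (1 / (1 + norm x) ^ k * (1 / (1 + norm \<omega>) ^ k))"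
proof -
  obtain C0 where C0: "\<And>x \<omega>. (1 + norm x) ^ k * norm (tau_wigner T u v x \<omega>) \<le> C0"
    using tau_wigner_bound[OF assms] by blast
  have "\<forall>b\<in>Basis. \<exists>C. \<forall>x \<omega>. (1 + norm x) ^ k * \<bar>\<omega> \<bullet> b\<bar> ^ k * norm (tau_wigner T u v x \<omega>) \<le> C"
    using tau_wigner_bound_frequency[OF assms(1) _ assms(2,3)] by blast
  then obtain C1 where C1: "\<And>b x \<omega>. b \<in> Basis \<Longrightarrow>
      (1 + norm x) ^ k * \<bar>\<omega> \<bullet> b\<bar> ^ k * norm (tau_wigner T u v x \<omega>) \<le> C1 b"
    unfolding bchoice_iff by blast
  define C where "C = (1 + DIM('a)) ^ k * (C0 + (\<Sum>b\<in>Basis. C1 b))"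
  have "(1 + norm x) ^ k * (1 + norm \<omega>) ^ k * norm (tau_wigner T u v x \<omega>) \<le> C" for x \<omega>
  proof -
    let ?w = "(1 + norm x) ^ k * norm (tau_wigner T u v x \<omega>)"
    have "(1 + norm \<omega>) ^ k * ?w \<le> ((1 + DIM('a)) ^ k * (1 + (\<Sum>b\<in>Basis. \<bar>\<omega> \<bullet> b\<bar> ^ k))) * ?w"
      by (intro mult_right_mono norm_power_le_coordinates) simp
    also have "\<dots> = (1 + DIM('a)) ^ k * (?w + (\<Sum>b\<in>Basis. \<bar>\<omega> \<bullet> b\<bar> ^ k * ?w))"
      by (simp only: distrib_right mult.assoc mult_1 sum_distrib_right)
    also have "\<dots> \<le> C"
      unfolding C_def
    proof (intro mult_left_mono add_mono C0 sum_mono)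
      fix b :: 'a assume "b \<in> Basis"
      from C1[OF this, of x \<omega>] show "\<bar>\<omega> \<bullet> b\<bar> ^ k * ?w \<le> C1 b" by (simp add: mult_ac)
    qed simp
    finally show ?thesis by (simp add: mult_ac)
  qed
  note bd = this
  have "norm (tau_wigner T u v x \<omega>) \<le> C * (1 / (1 + norm x) ^ k * (1 / (1 + norm \<omega>) ^ k))" for x \<omega>
    using bd[of x \<omega>] by (simp add: pos_le_divide_eq add_pos_nonneg mult_ac)
  moreover have "C \<ge> 0"
    using bd[of 0 0] by (rule order_trans[rotated]) simp
  ultimately show ?thesis by blast
qed

lemma tau_wigner_measurable_pair:
  fixes T :: "'a::euclidean_space \<Rightarrow> 'a"
  assumes "linear T" "schwartz u" "schwartz v"
  shows "(\<lambda>(x, \<omega>). tau_wigner T u v x \<omega>) \<in> borel_measurable (borel \<Otimes>\<^sub>M borel)"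
proof -
  note [measurable] = twist_measurable_pair[OF assms]
  have [measurable]: "(\<lambda>(z, y). twist T u v (fst z) y) \<in> borel_measurable ((borel \<Otimes>\<^sub>M (borel :: 'a measure)) \<Otimes>\<^sub>M lborel)"
    by measurable
  show ?thesis unfolding tau_wigner_def fourier_phase by measurable
qed

lemma tau_wigner_integrable:
  fixes T :: "'a::euclidean_space \<Rightarrow> 'a"
  assumes "linear T" "schwartz u" "schwartz v"
  shows tau_wigner_integrable_pair: "integrable (lborel \<Otimes>\<^sub>M lborel) (\<lambda>(x, \<omega>). tau_wigner T u v x \<omega>)"
    and tau_wigner_integrable_space: "integrable lborel (\<lambda>x. tau_wigner T u v x \<omega>)"
    and tau_wigner_integrable_frequency: "integrable lborel (tau_wigner T u v x)"
proof -
  let ?k = "2 * DIM('a)"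
  let ?q = "\<lambda>x::'a. complex_of_real (1 / (1 + norm x) ^ ?k)"
  have q: "integrable lborel ?q"
    by (intro integrable_of_real integrable_inverse_power_norm)
  obtain C where C: "C \<ge> 0"
    "\<And>x \<omega>. norm (tau_wigner T u v x \<omega>) \<le> C * (1 / (1 + norm x) ^ ?k * (1 / (1 + norm \<omega>) ^ ?k))"
    using tau_wigner_decay[OF assms, of ?k] by blast
  have le: "norm (tau_wigner T u v x \<omega>) \<le> norm (complex_of_real C * (?q x * ?q \<omega>))" for x \<omega>
    using C(1) C(2)[of x \<omega>] unfolding norm_mult norm_of_real by simp
  note [measurable] = tau_wigner_measurable_pair[OF assms]
  have "integrable (lborel \<Otimes>\<^sub>M lborel) (\<lambda>z. complex_of_real C * (case z of (x, \<omega>) \<Rightarrow> ?q x * ?q \<omega>))"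
    by (intro integrable_mult_right integrable_times_pair q)
  then show "integrable (lborel \<Otimes>\<^sub>M lborel) (\<lambda>(x, \<omega>). tau_wigner T u v x \<omega>)"
  proof (rule Bochner_Integration.integrable_bound)
    show "AE z in lborel \<Otimes>\<^sub>M lborel. norm (case z of (x, \<omega>) \<Rightarrow> tau_wigner T u v x \<omega>)
        \<le> norm (complex_of_real C * (case z of (x, \<omega>) \<Rightarrow> ?q x * ?q \<omega>))"
      by (rule AE_I2) (simp only: case_prod_unfold le)
  qed measurable
  have "integrable lborel (\<lambda>x. complex_of_real C * (?q x * ?q \<omega>))"
    by (intro integrable_mult_right integrable_mult_left q)
  then show "integrable lborel (\<lambda>x. tau_wigner T u v x \<omega>)"
    by (rule Bochner_Integration.integrable_bound) (use le in auto)
  have "integrable lborel (\<lambda>\<omega>. complex_of_real C * (?q x * ?q \<omega>))"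
    by (intro integrable_mult_right q)
  then show "integrable lborel (tau_wigner T u v x)"
    by (rule Bochner_Integration.integrable_bound) (use le in auto)
qed

lemma fourier_twist_integrable:
  fixes T :: "'a::euclidean_space \<Rightarrow> 'a"
  assumes "linear T" "schwartz f" "schwartz g"
  shows "integrable lborel (fourier (twist T f g x))"
  using tau_wigner_integrable_frequency[OF assms] unfolding tau_wigner_def .

lemma tau_wigner_bounded:
  assumes "linear T" "schwartz f" "schwartz g"
  obtains B where "\<And>x \<omega>. norm (tau_wigner T f g x \<omega>) \<le> B"
proof -
  obtain C where "\<And>x \<omega>. norm (tau_wigner T f g x \<omega>) \<le> C * (1 / (1 + norm x) ^ 0 * (1 / (1 + norm \<omega>) ^ 0))"
    using tau_wigner_decay[OF assms, of 0] by blast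
  then show thesis using that[of C] by simp
qed

section \<open>Marginals, Moyal's identity, symmetries and convolutions\<close>

lemma schwartz_integrable: "schwartz f \<Longrightarrow> integrable lborel f"
  by (intro rapidly_decreasing_integrable schwartz_rapidly_decreasing schwartz_measurable)

text \<open>
Fourier inversion at \<open>y = 0\<close>, where both arguments of the twisted product equal \<open>x\<close>.
\<close>

lemma tau_wigner_marginal_frequency:
  fixes T :: "'a::euclidean_space \<Rightarrow> 'a"
  assumes T: "linear T" and f: "schwartz f"
  shows "has_bochner_integral lborel (\<lambda>\<omega>. tau_wigner T f f x \<omega>) (complex_of_real ((norm (f x))\<^sup>2))"
proof -
  obtain B where B: "\<And>y. norm (twist T f f x y) \<le> B" using twist_bounded[OF T f f] by blast
  have "(\<integral>\<eta>. phase (\<eta> \<bullet> 0) * fourier (twist T f f x) \<eta> \<partial>lborel) = twist T f f x 0"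
    by (rule fourier_inversion[OF twist_continuous[OF T f f] twist_integrable[OF T f f] B
        fourier_twist_integrable[OF T f f]])
  also have "\<dots> = f x * cnj (f x)" using linear_0[OF T] by (simp add: twist_def)
  finally show ?thesis
    using tau_wigner_integrable_frequency[OF T f f, of x]
    unfolding has_bochner_integral_iff complex_norm_square tau_wigner_def by simp
qed

text \<open>
The difference of the two arguments \<open>s\<close>, \<open>s'\<close> of the twisted product is \<open>y\<close>, so the character of \<open>y\<close> splits
into one of \<open>s\<close> and a conjugate one of \<open>s'\<close>. After the measure-preserving substitution the double
integral is a product of two Fourier integrals.
\<close>

lemma tau_wigner_marginal_space:
  fixes T :: "'a::euclidean_space \<Rightarrow> 'a"
  assumes T: "linear T" and f: "schwartz f"
  shows "has_bochner_integral lborel (\<lambda>x. tau_wigner T f f x \<omega>) (complex_of_real ((norm (fourier f \<omega>))\<^sup>2))"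
proof -
  let ?h = "\<lambda>s. phase (- (s \<bullet> \<omega>)) * f s"
  let ?H = "\<lambda>(s, s'). ?h s * cnj (?h s')"
  have h: "integrable lborel ?h"
    by (intro integrable_phase_mult schwartz_integrable f) measurable
  then have h': "integrable lborel (\<lambda>s. cnj (?h s))" by (rule integrable_cnj)
  have e: "(\<lambda>(t, y). ?H (t + T y, t + T y - y)) = (\<lambda>(t, y). phase (- (y \<bullet> \<omega>)) * twist T f f t y)"
  proof (intro ext, clarify)
    fix t y
    have "- ((t + T y) \<bullet> \<omega>) + (t + T y - y) \<bullet> \<omega> = - (y \<bullet> \<omega>)" by (simp add: inner_diff_left)
    then have "phase (- (y \<bullet> \<omega>)) = phase (- ((t + T y) \<bullet> \<omega>)) * phase ((t + T y - y) \<bullet> \<omega>)"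
      by (simp only: phase_add[symmetric])
    then show "?h (t + T y) * cnj (?h (t + T y - y)) = phase (- (y \<bullet> \<omega>)) * twist T f f t y"
      by (simp add: twist_def cnj_phase mult_ac)
  qed
  have i: "integrable (lborel \<Otimes>\<^sub>M lborel) ?H" by (rule integrable_times_pair[OF h h'])
  have "(\<integral>x. tau_wigner T f f x \<omega> \<partial>lborel)
      = (\<integral>z. (case z of (t, y) \<Rightarrow> ?H (t + T y, t + T y - y)) \<partial>(lborel \<Otimes>\<^sub>M lborel))"
    using lborel_pair.integral_fst'[OF integrable_shear[OF T i]]
    unfolding e tau_wigner_def fourier_phase by simp
  also have "\<dots> = fourier f \<omega> * cnj (fourier f \<omega>)"
    unfolding integral_shear[OF T i] integral_times_pair[OF h h'] fourier_phase
    by (rule arg_cong[OF Bochner_Integration.integral_cnj])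
  finally show ?thesis
    using tau_wigner_integrable_space[OF T f f]
    unfolding has_bochner_integral_iff complex_norm_square by simp
qed

lemma tau_wigner_total:
  fixes T :: "'a::euclidean_space \<Rightarrow> 'a"
  assumes T: "linear T" and f: "schwartz f"
  shows "has_bochner_integral (lborel \<Otimes>\<^sub>M lborel) (\<lambda>(x, \<omega>). tau_wigner T f f x \<omega>)
     (complex_of_real ((L2_norm f)\<^sup>2))"
proof -
  note i = tau_wigner_integrable_pair[OF T f f]
  have "(\<integral>z. (case z of (x, \<omega>) \<Rightarrow> tau_wigner T f f x \<omega>) \<partial>(lborel \<Otimes>\<^sub>M lborel))
      = (\<integral>x. complex_of_real ((norm (f x))\<^sup>2) \<partial>lborel)"
    using lborel_pair.integral_fst'[OF i] has_bochner_integral_integral_eq[OF tau_wigner_marginal_frequency[OF T f]]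
    by simp
  also have "\<dots> = complex_of_real ((L2_norm f)\<^sup>2)"
    unfolding L2_norm_def integral_complex_of_real by (simp add: Bochner_Integration.integral_nonneg)
  finally show ?thesis using i unfolding has_bochner_integral_iff by simp
qed

text \<open>
For fixed \<open>x\<close>, Parseval's identity moves the inner product from \<open>\<omega>\<close> to \<open>y\<close>. The remaining integral over
\<open>(x,y)\<close> is, after the measure-preserving substitution, the integral of \<open>f cnj g\<close> times its conjugate.
\<close>

lemma tau_wigner_moyal:
  fixes T :: "'a::euclidean_space \<Rightarrow> 'a"
  assumes T: "linear T" and f: "schwartz f" and g: "schwartz g"
  shows "has_bochner_integral (lborel \<Otimes>\<^sub>M lborel)
      (\<lambda>(x, \<omega>). tau_wigner T f f x \<omega> * cnj (tau_wigner T g g x \<omega>))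
      (complex_of_real ((norm (L2_inner f g))\<^sup>2))"
proof -
  note [measurable] = tau_wigner_measurable_pair[OF T g g]
  obtain B where B: "\<And>x \<omega>. norm (tau_wigner T g g x \<omega>) \<le> B" using tau_wigner_bounded[OF T g g] by blast
  have i: "integrable (lborel \<Otimes>\<^sub>M lborel) (\<lambda>z. (case z of (x, \<omega>) \<Rightarrow> tau_wigner T f f x \<omega>)
      * (case z of (x, \<omega>) \<Rightarrow> cnj (tau_wigner T g g x \<omega>)))"
    by (rule integrable_mult_bounded[OF tau_wigner_integrable_pair[OF T f f], where B = B])
       (use B in \<open>auto simp: split_beta\<close>)
  then have i: "integrable (lborel \<Otimes>\<^sub>M lborel)
      (\<lambda>(x, \<omega>). tau_wigner T f f x \<omega> * cnj (tau_wigner T g g x \<omega>))"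
    by (simp add: case_prod_unfold)
  let ?h = "\<lambda>s. f s * cnj (g s)"
  let ?H = "\<lambda>(s, s'). ?h s * cnj (?h s')"
  obtain Bg where Bg: "\<And>s. norm (g s) \<le> Bg"
    using rapidly_decreasing_bounded[OF schwartz_rapidly_decreasing[OF g]] by blast
  have h: "integrable lborel ?h"
    using schwartz_measurable[OF g] Bg
    by (intro integrable_mult_bounded[where B = Bg] schwartz_integrable f) auto
  then have h': "integrable lborel (\<lambda>s. cnj (?h s))" by (rule integrable_cnj)
  have e: "(\<lambda>(t, y). ?H (t + T y, t + T y - y)) = (\<lambda>(t, y). twist T f f t y * cnj (twist T g g t y))"
    by (simp add: twist_def mult_ac)
  have iH: "integrable (lborel \<Otimes>\<^sub>M lborel) ?H" by (rule integrable_times_pair[OF h h'])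
  have par: "(\<integral>\<omega>. tau_wigner T f f x \<omega> * cnj (tau_wigner T g g x \<omega>) \<partial>lborel)
      = (\<integral>y. twist T f f x y * cnj (twist T g g x y) \<partial>lborel)" for x
  proof -
    obtain B where B: "\<And>y. norm (twist T f f x y) \<le> B" using twist_bounded[OF T f f] by blast
    show ?thesis
      unfolding tau_wigner_def
      by (rule parseval[OF twist_continuous[OF T f f] twist_integrable[OF T f f] B
          fourier_twist_integrable[OF T f f] twist_integrable[OF T g g]])
  qed
  have "(\<integral>z. (case z of (x, \<omega>) \<Rightarrow> tau_wigner T f f x \<omega> * cnj (tau_wigner T g g x \<omega>)) \<partial>(lborel \<Otimes>\<^sub>M lborel))
      = (\<integral>x. \<integral>y. twist T f f x y * cnj (twist T g g x y) \<partial>lborel \<partial>lborel)"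
    using lborel_pair.integral_fst'[OF i] by (simp only: prod.case par)
  also have "\<dots> = (\<integral>z. (case z of (t, y) \<Rightarrow> ?H (t + T y, t + T y - y)) \<partial>(lborel \<Otimes>\<^sub>M lborel))"
    using lborel_pair.integral_fst'[OF integrable_shear[OF T iH]] unfolding e by (simp only: prod.case)
  also have "\<dots> = L2_inner f g * cnj (L2_inner f g)"
    unfolding integral_shear[OF T iH] integral_times_pair[OF h h'] L2_inner_def
    by (rule arg_cong[OF Bochner_Integration.integral_cnj])
  finally show ?thesis using i unfolding has_bochner_integral_iff complex_norm_square by simp
qed

lemma tau_wigner_reflect:
  fixes T :: "'a::euclidean_space \<Rightarrow> 'a"
  assumes T: "linear T" and f: "schwartz f"
  shows "tau_wigner T (reflect f) (reflect f) x \<omega> = tau_wigner T f f (- x) (- \<omega>)"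
proof -
  note [measurable] = twist_measurable[OF T f f]
  have tw: "twist T (reflect f) (reflect f) x y = twist T f f (- x) (0 - y)" for y
    by (simp add: twist_def reflect_def linear_neg[OF T] algebra_simps)
  have "tau_wigner T (reflect f) (reflect f) x \<omega>
      = (\<integral>y. phase ((0 - y) \<bullet> \<omega>) * twist T f f (- x) (0 - y) \<partial>lborel)"
    unfolding tau_wigner_def fourier_phase tw by simp
  also have "\<dots> = (\<integral>y. phase (y \<bullet> \<omega>) * twist T f f (- x) y \<partial>lborel)"
    by (rule integral_lborel_reflect) measurable
  finally show ?thesis unfolding tau_wigner_def fourier_phase by simp
qed

lemma tau_wigner_cnj:
  "tau_wigner T (\<lambda>t. cnj (f t)) (\<lambda>t. cnj (f t)) x \<omega> = cnj (tau_wigner T f f x (- \<omega>))"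
  unfolding tau_wigner_def cnj_fourier by (simp add: twist_def[abs_def])

lemma tau_wigner_dilate:
  fixes T :: "'a::euclidean_space \<Rightarrow> 'a"
  assumes T: "linear T" and f: "schwartz f" and r: "r \<noteq> 0"
  shows "tau_wigner T (dilate r f) (dilate r f) x \<omega> = tau_wigner T f f (r *\<^sub>R x) (inverse r *\<^sub>R \<omega>)"
proof -
  note [measurable] = twist_measurable[OF T f f]
  have "\<bar>r\<bar> powr (DIM('a) / 2) * \<bar>r\<bar> powr (DIM('a) / 2) = \<bar>r\<bar> ^ DIM('a)"
    using r by (simp add: powr_add[symmetric] powr_realpow)
  then have tw: "twist T (dilate r f) (dilate r f) x y = \<bar>r\<bar> ^ DIM('a) *\<^sub>R twist T f f (r *\<^sub>R x) (r *\<^sub>R y)" for y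
    by (simp add: twist_def dilate_def linear_cmul[OF T] algebra_simps)
  have "tau_wigner T f f (r *\<^sub>R x) (inverse r *\<^sub>R \<omega>)
      = \<bar>r\<bar> ^ DIM('a) *\<^sub>R (\<integral>y. phase (- ((0 + r *\<^sub>R y) \<bullet> (inverse r *\<^sub>R \<omega>))) * twist T f f (r *\<^sub>R x) (0 + r *\<^sub>R y) \<partial>lborel)"
    unfolding tau_wigner_def fourier_phase using r by (intro integral_lborel_affine) auto
  also have "\<dots> = (\<integral>y. phase (- (y \<bullet> \<omega>)) * twist T (dilate r f) (dilate r f) x y \<partial>lborel)"
  proof -
    have e: "- ((0 + r *\<^sub>R y) \<bullet> (inverse r *\<^sub>R \<omega>)) = - (y \<bullet> \<omega>)" for y using r by simp
    show ?thesis unfolding integral_scaleR_right[symmetric] tw e by simp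
  qed
  finally show ?thesis unfolding tau_wigner_def fourier_phase ..
qed

text \<open>
The twisted product of a pointwise product is the pointwise product of the twisted products.
\<close>

lemma tau_wigner_times:
  fixes T :: "'a::euclidean_space \<Rightarrow> 'a"
  assumes T: "linear T" and f: "schwartz f" and g: "schwartz g"
  shows "integrable lborel (\<lambda>\<eta>. tau_wigner T f f x \<eta> * tau_wigner T g g x (\<omega> - \<eta>))"
    and "tau_wigner T (\<lambda>t. f t * g t) (\<lambda>t. f t * g t) x \<omega>
      = conv (tau_wigner T f f x) (tau_wigner T g g x) \<omega>"
proof -
  note [measurable] = tau_wigner_measurable_pair[OF T g g]
  obtain C where C: "\<And>x \<omega>. norm (tau_wigner T g g x \<omega>) \<le> C" using tau_wigner_bounded[OF T g g] by blast
  show "integrable lborel (\<lambda>\<eta>. tau_wigner T f f x \<eta> * tau_wigner T g g x (\<omega> - \<eta>))"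
    by (rule integrable_mult_bounded[OF tau_wigner_integrable_frequency[OF T f f], where B = C])
       (use C in auto)
  obtain B where B: "\<And>y. norm (twist T f f x y) \<le> B" using twist_bounded[OF T f f] by blast
  have "twist T (\<lambda>t. f t * g t) (\<lambda>t. f t * g t) x = (\<lambda>y. twist T f f x y * twist T g g x y)"
    by (simp add: twist_def[abs_def] mult_ac)
  then show "tau_wigner T (\<lambda>t. f t * g t) (\<lambda>t. f t * g t) x \<omega>
      = conv (tau_wigner T f f x) (tau_wigner T g g x) \<omega>"
    unfolding tau_wigner_def
    using conv_fourier[OF twist_continuous[OF T f f] twist_integrable[OF T f f] B
        fourier_twist_integrable[OF T f f] twist_integrable[OF T g g]] by simp
qed

text \<open>
The twisted product of \<open>f * g\<close> at \<open>(x,y)\<close> is a double integral over the integration variables of the two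
convolutions. In the sheared variables \<open>(t,y')\<close> it becomes the convolution, in both variables, of
the twisted products of \<open>f\<close> and \<open>g\<close>. Taking the Fourier transform in \<open>y\<close> turns the convolution
in \<open>y\<close> into a product and leaves the one in \<open>x\<close>.
\<close>

lemma tau_wigner_conv:
  fixes T :: "'a::euclidean_space \<Rightarrow> 'a"
  assumes T: "linear T" and f: "schwartz f" and g: "schwartz g"
  shows "integrable lborel (\<lambda>t. tau_wigner T f f t \<omega> * tau_wigner T g g (x - t) \<omega>)"
    and "tau_wigner T (conv f g) (conv f g) x \<omega>
      = conv (\<lambda>t. tau_wigner T f f t \<omega>) (\<lambda>t. tau_wigner T g g t \<omega>) x"
proof -
  note [measurable] = linear_measurable[OF T] schwartz_measurable[OF f] schwartz_measurable[OF g]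
    tau_wigner_measurable_pair[OF T g g] twist_measurable_pair[OF T f f] twist_measurable_pair[OF T g g]
  obtain B where B: "\<And>x \<omega>. norm (tau_wigner T g g x \<omega>) \<le> B"
    using tau_wigner_bounded[OF T g g] by blast
  show "integrable lborel (\<lambda>t. tau_wigner T f f t \<omega> * tau_wigner T g g (x - t) \<omega>)"
    by (rule integrable_mult_bounded[OF tau_wigner_integrable_space[OF T f f], where B = B])
       (use B in auto)

  define ph where "ph y = phase (- (y \<bullet> \<omega>))" for y
  have ph_measurable [measurable]: "ph \<in> borel_measurable borel"
    unfolding ph_def[abs_def] by measurable
  have ph_norm [simp]: "norm (ph y) = 1" for y unfolding ph_def by simp
  have ph_add: "ph (y + y') = ph y * ph y'" for y y'
    unfolding ph_def phase_add[symmetric] by (simp add: inner_add_left)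
  have W: "tau_wigner T u v t \<omega> = (\<integral>y. ph y * twist T u v t y \<partial>lborel)" for u v t
    unfolding tau_wigner_def fourier_phase ph_def ..

  obtain Bg where Bg: "\<And>s. norm (g s) \<le> Bg"
    using rapidly_decreasing_bounded[OF schwartz_rapidly_decreasing[OF g]] by blast
  have conv_int: "integrable lborel (\<lambda>s. f s * g (p - s))" for p
    by (rule integrable_mult_bounded[OF schwartz_integrable[OF f], where B = Bg]) (use Bg in auto)

  have tw_conv: "twist T (conv f g) (conv f g) x y
      = (\<integral>z. (case z of (t, y') \<Rightarrow> twist T f f t y' * twist T g g (x - t) (y - y')) \<partial>(lborel \<Otimes>\<^sub>M lborel))" for y
  proof -
    let ?p = "x + T y" and ?q = "x + T y - y"
    \<comment> \<open>The integrand of the product of the convolutions at the two arguments \<open>?p\<close> and \<open>?q\<close>.\<close>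
    let ?H = "\<lambda>(s, s'). (f s * g (?p - s)) * cnj (f s' * g (?q - s'))"
    have h': "integrable lborel (\<lambda>s'. cnj (f s' * g (?q - s')))" using conv_int by (rule integrable_cnj)
    have i: "integrable (lborel \<Otimes>\<^sub>M lborel) ?H" by (rule integrable_times_pair[OF conv_int h'])
    have "twist T (conv f g) (conv f g) x y = (\<integral>z. ?H z \<partial>(lborel \<Otimes>\<^sub>M lborel))"
      unfolding integral_times_pair[OF conv_int h'] Bochner_Integration.integral_cnj twist_def conv_def ..
    also have "\<dots> = (\<integral>z. (case z of (t, y') \<Rightarrow> ?H (t + T y', t + T y' - y')) \<partial>(lborel \<Otimes>\<^sub>M lborel))"
      by (rule integral_shear[OF T i, symmetric])
    also have "(\<lambda>(t, y'). ?H (t + T y', t + T y' - y'))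
        = (\<lambda>(t, y'). twist T f f t y' * twist T g g (x - t) (y - y'))"
    proof (intro ext, clarify)
      fix t y'
      have "?p - (t + T y') = (x - t) + T (y - y')" "?q - (t + T y' - y') = (x - t) + T (y - y') - (y - y')"
        by (simp_all add: linear_diff[OF T])
      then show "(f (t + T y') * g (?p - (t + T y'))) * cnj (f (t + T y' - y') * g (?q - (t + T y' - y')))
          = twist T f f t y' * twist T g g (x - t) (y - y')"
        unfolding twist_def by (simp only: complex_cnj_mult mult_ac)
    qed
    finally show ?thesis .
  qed

  let ?r = "\<lambda>z y. case z of (t, y') \<Rightarrow> twist T f f t y' * (ph y * twist T g g (x - t) (y - y'))"
  \<comment> \<open>The integral of \<open>norm (?r z y)\<close> over \<open>y\<close> is \<open>norm (twist T f f t y') * N (x - t)\<close> for \<open>z = (t, y')\<close>;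
    boundedness of \<open>N\<close> therefore gives integrability of \<open>?r\<close> on the triple product.\<close>
  define N where "N t = (\<integral>y. norm (twist T g g t y) \<partial>lborel)" for t
  obtain C where C0: "\<And>t y. (1 + norm y) ^ (2 * DIM('a)) * norm (twist T g g t y) \<le> C"
    using twist_bound_uniform[OF T g g, of "2 * DIM('a)"] by blast
  have C: "norm (twist T g g t y) \<le> C * (1 / (1 + norm y) ^ (2 * DIM('a)))" for t y
    using C0[of y t] by (simp add: pos_le_divide_eq add_pos_nonneg mult.commute)
  have "N t \<le> (\<integral>y. C * (1 / (1 + norm (y::'a)) ^ (2 * DIM('a))) \<partial>lborel)" for t
    unfolding N_def
    by (intro integral_mono integrable_norm twist_integrable T g C integrable_mult_right
        integrable_inverse_power_norm)
  then obtain M where M: "\<And>t. N t \<le> M" by blast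
  have N0: "0 \<le> N t" for t unfolding N_def by (simp add: Bochner_Integration.integral_nonneg)
  have N_measurable [measurable]: "N \<in> borel_measurable borel"
    unfolding N_def[abs_def] by measurable
  have shift: "(\<integral>y. norm (twist T g g t (y - y')) \<partial>lborel) = N t" for t y'
  proof -
    have "(\<lambda>y. norm (twist T g g t y)) \<in> borel_measurable borel" by measurable
    from integral_lborel_translate[OF this, of "- y'"] show ?thesis unfolding N_def by simp
  qed
  have twf: "integrable (lborel \<Otimes>\<^sub>M lborel) (\<lambda>(t, y'). twist T f f t y')"
  proof -
    let ?H = "\<lambda>(s, s'). f s * cnj (f s')"
    have "integrable (lborel \<Otimes>\<^sub>M lborel) ?H"
      by (intro integrable_times_pair integrable_cnj schwartz_integrable f)
    from integrable_shear[OF T this] show ?thesis by (simp add: twist_def)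
  qed
  interpret P: pair_sigma_finite "lborel \<Otimes>\<^sub>M lborel :: ('a \<times> 'a) measure" "lborel :: 'a measure"
    unfolding lborel_prod by standard
  have R: "integrable ((lborel \<Otimes>\<^sub>M lborel) \<Otimes>\<^sub>M lborel) (case_prod ?r)"
  proof (rule P.Fubini_integrable)
    show "case_prod ?r \<in> borel_measurable ((lborel \<Otimes>\<^sub>M lborel) \<Otimes>\<^sub>M lborel)" by measurable
    have "integrable (lborel \<Otimes>\<^sub>M lborel)
        (\<lambda>z. norm (case z of (t, y') \<Rightarrow> twist T f f t y') * N (x - fst z))"
      by (rule integrable_mult_bounded[OF integrable_norm[OF twf], where B = M])
         (use M N0 in auto)
    moreover have "(\<integral>y. norm (case_prod ?r (z, y)) \<partial>lborel)
        = norm (case z of (t, y') \<Rightarrow> twist T f f t y') * N (x - fst z)" for z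
      by (simp add: case_prod_unfold norm_mult shift)
    ultimately show "integrable (lborel \<Otimes>\<^sub>M lborel) (\<lambda>z. \<integral>y. norm (case_prod ?r (z, y)) \<partial>lborel)"
      by presburger
    have "integrable lborel (\<lambda>y. ?r z y)" for z
    proof -
      have "twist T g g (x - fst z) \<in> borel_measurable borel" by (rule twist_measurable[OF T g g])
      from integrable_lborel_translate[OF this, of "- snd z"]
      have "integrable lborel (\<lambda>y. twist T g g (x - fst z) (y - snd z))"
        by (simp add: twist_integrable[OF T g g])
      then have "integrable lborel (\<lambda>y. ph y * twist T g g (x - fst z) (y - snd z))"
        unfolding ph_def by (rule integrable_phase_mult) measurable
      then show ?thesis by (simp add: case_prod_unfold)
    qed
    then show "AE z in lborel \<Otimes>\<^sub>M lborel. integrable lborel (\<lambda>y. case_prod ?r (z, y))" by simp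
  qed
  have "tau_wigner T (conv f g) (conv f g) x \<omega> = (\<integral>y. \<integral>z. ?r z y \<partial>(lborel \<Otimes>\<^sub>M lborel) \<partial>lborel)"
    unfolding W tw_conv integral_mult_right_zero[symmetric]
    by (simp only: case_prod_unfold mult.left_commute)
  also have "\<dots> = (\<integral>z. \<integral>y. ?r z y \<partial>lborel \<partial>(lborel \<Otimes>\<^sub>M lborel))"
    by (rule P.Fubini_integral[OF R])
  also have "\<dots> = (\<integral>z. (case z of (t, y') \<Rightarrow> (ph y' * twist T f f t y') * tau_wigner T g g (x - t) \<omega>) \<partial>(lborel \<Otimes>\<^sub>M lborel))"
  proof (intro Bochner_Integration.integral_cong refl, clarify)
    fix t y'
    have m: "(\<lambda>y. ph y * twist T g g (x - t) (y - y')) \<in> borel_measurable borel" by measurable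
    have "(\<integral>y. ph y * twist T g g (x - t) (y - y') \<partial>lborel)
        = (\<integral>y. ph (y + y') * twist T g g (x - t) (y + y' - y') \<partial>lborel)"
      by (rule integral_lborel_translate[OF m, symmetric])
    also have "\<dots> = ph y' * tau_wigner T g g (x - t) \<omega>"
      unfolding W integral_mult_right_zero[symmetric] ph_add by (simp add: mult_ac)
    finally show "(\<integral>y. twist T f f t y' * (ph y * twist T g g (x - t) (y - y')) \<partial>lborel)
        = (ph y' * twist T f f t y') * tau_wigner T g g (x - t) \<omega>"
      unfolding integral_mult_right_zero by (simp only: mult_ac)
  qed
  also have "\<dots> = (\<integral>t. \<integral>y'. (ph y' * twist T f f t y') * tau_wigner T g g (x - t) \<omega> \<partial>lborel \<partial>lborel)"
  proof -
    have "integrable (lborel \<Otimes>\<^sub>M lborel) (\<lambda>z. (case z of (t, y') \<Rightarrow> twist T f f t y') * ph (snd z))"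
      by (rule integrable_mult_bounded[OF twf, where B = 1]) auto
    then have "integrable (lborel \<Otimes>\<^sub>M lborel)
        (\<lambda>z. ((case z of (t, y') \<Rightarrow> twist T f f t y') * ph (snd z)) * tau_wigner T g g (x - fst z) \<omega>)"
      by (rule integrable_mult_bounded[where B = B]) (use B in auto)
    then have "integrable (lborel \<Otimes>\<^sub>M lborel)
        (\<lambda>(t, y'). (ph y' * twist T f f t y') * tau_wigner T g g (x - t) \<omega>)"
      by (simp add: case_prod_unfold mult.commute)
    from lborel_pair.integral_fst'[OF this] show ?thesis by simp
  qed
  also have "\<dots> = conv (\<lambda>t. tau_wigner T f f t \<omega>) (\<lambda>t. tau_wigner T g g t \<omega>) x"
    unfolding conv_def integral_mult_left_zero W ..
  finally show "tau_wigner T (conv f g) (conv f g) x \<omega>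
      = conv (\<lambda>t. tau_wigner T f f t \<omega>) (\<lambda>t. tau_wigner T g g t \<omega>) x" .
qed

section \<open>Rigidity of the Cohen class\<close>

definition stack :: "real^'d::finite \<Rightarrow> real^'d \<Rightarrow> real^('d + 'd)" where
  "stack x y = (\<chi> i. case i of Inl j \<Rightarrow> x $ j | Inr j \<Rightarrow> y $ j)"

lemma stack_nth [simp]: "stack x y $ Inl i = x $ i" "stack x y $ Inr i = y $ i"
  by (simp_all add: stack_def)

lemma sum_UNIV_Plus:
  fixes h :: "'d::finite + 'd \<Rightarrow> real"
  shows "sum h UNIV = (\<Sum>j\<in>UNIV. h (Inl j)) + (\<Sum>j\<in>UNIV. h (Inr j))"
  unfolding UNIV_Plus_UNIV[symmetric] by (subst sum.Plus) (simp_all add: o_def)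

lemma matrix_vector_mult_stack:
  "A *v stack x y = stack (block11 A *v x + block12 A *v y) (block21 A *v x + block22 A *v y)"
proof -
  have "(A *v stack x y) $ i
      = stack (block11 A *v x + block12 A *v y) (block21 A *v x + block22 A *v y) $ i" for i
    by (cases i) (simp_all add: matrix_vector_mult_def sum_UNIV_Plus
        block11_def block12_def block21_def block22_def)
  then show ?thesis by (simp add: vec_eq_iff)
qed

lemma stack_eq_iff: "stack x y = stack x' y' \<longleftrightarrow> x = x' \<and> y = y'"
  unfolding vec_eq_iff by (metis stack_nth sum.exhaust)

lemma stack_cases: obtains x y where "w = stack x y"
proof
  show "w = stack (\<chi> j. w $ Inl j) (\<chi> j. w $ Inr j)"
    unfolding vec_eq_iff
  proof
    fix i show "w $ i = stack (\<chi> j. w $ Inl j) (\<chi> j. w $ Inr j) $ i" by (cases i) simp_all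
  qed
qed

lemma block_system_solvable:
  fixes A :: "real^('d::finite + 'd)^('d + 'd)"
  assumes "invertible A"
  obtains x y where "block11 A *v x + block12 A *v y = p" "block21 A *v x + block22 A *v y = q"
proof -
  obtain B where B: "A ** B = mat 1" using assms unfolding invertible_def by blast
  obtain x y where xy: "B *v stack p q = stack x y" by (rule stack_cases)
  have "A *v stack x y = stack p q"
    unfolding xy[symmetric] matrix_vector_mul_assoc B by simp
  then show thesis using that unfolding matrix_vector_mult_stack stack_eq_iff by blast
qed

lemma block_column_injective:
  fixes A :: "real^('d::finite + 'd)^('d + 'd)"
  assumes "invertible A"
  shows "inj (\<lambda>y. (block12 A *v y, block22 A *v y))"
proof (rule injI)
  fix y y'
  assume e: "(block12 A *v y, block22 A *v y) = (block12 A *v y', block22 A *v y')"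
  obtain B where B: "B ** A = mat 1" using assms unfolding invertible_def by blast
  have "A *v stack 0 y = A *v stack 0 y'" using e unfolding matrix_vector_mult_stack by simp
  then have "B *v (A *v stack 0 y) = B *v (A *v stack 0 y')" by simp
  then show "y = y'" unfolding matrix_vector_mul_assoc B by (simp add: stack_eq_iff)
qed

text \<open>
An injective linear map is bounded below, so \<open>norm y\<close> is controlled by \<open>norm (L y) + norm (M y)\<close>.
\<close>

lemma rapidly_decreasing_product_compose:
  fixes L M :: "'a::euclidean_space \<Rightarrow> 'b::euclidean_space"
  assumes u: "rapidly_decreasing u" and v: "rapidly_decreasing v"
    and L: "linear L" and M: "linear M" and inj: "inj (\<lambda>y. (L y, M y))"
  shows "rapidly_decreasing (\<lambda>y. u (L y) * cnj (v (M y)))"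
  unfolding rapidly_decreasing_def
proof
  fix k :: nat
  have "linear (\<lambda>y. (L y, M y))"
    using L M by (auto simp: linear_iff)
  then obtain c where c: "c > 0" "\<And>y. c * norm y \<le> norm (L y, M y)"
    using linear_inj_bounded_below_pos[OF _ inj] by blast
  obtain Cu Cv where Cu: "\<And>x. (1 + norm x) ^ k * norm (u x) \<le> Cu"
    and Cv: "\<And>x. (1 + norm x) ^ k * norm (v x) \<le> Cv"
    using u v unfolding rapidly_decreasing_def by meson
  define K where "K = 1 + inverse c"
  have K: "K > 0" using c(1) by (simp add: K_def add_pos_pos)
  have "(1 + norm y) ^ k * norm (u (L y) * cnj (v (M y))) \<le> K ^ k * (Cu * Cv)" for y
  proof -
    have "c * norm y \<le> norm (L y) + norm (M y)"
      using c(2)[of y] norm_Pair_le[of "L y" "M y"] by linarith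
    then have y: "norm y \<le> inverse c * (norm (L y) + norm (M y))"
      using c(1) by (simp add: field_simps)
    define w where "w = (1 + norm (L y)) * (1 + norm (M y))"
    have w: "1 \<le> w" "norm (L y) + norm (M y) \<le> w" unfolding w_def ring_distribs by simp_all
    have "inverse c * (norm (L y) + norm (M y)) \<le> inverse c * w"
      using c(1) by (intro mult_left_mono w) simp
    then have "1 + norm y \<le> w + inverse c * w" using y w(1) by linarith
    also have "\<dots> = K * w" by (simp add: K_def distrib_right)
    finally have "(1 + norm y) ^ k \<le> (K * w) ^ k" by (intro power_mono) auto
    then have "(1 + norm y) ^ k * norm (u (L y) * cnj (v (M y)))
        \<le> (K * w) ^ k * norm (u (L y) * cnj (v (M y)))" by (rule mult_right_mono) simp
    also have "\<dots> = K ^ k * (((1 + norm (L y)) ^ k * norm (u (L y))) * ((1 + norm (M y)) ^ k * norm (v (M y))))"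
      unfolding w_def norm_mult complex_mod_cnj by (simp only: power_mult_distrib mult_ac)
    also have "\<dots> \<le> K ^ k * (Cu * Cv)"
      using K by (intro mult_left_mono mult_mono Cu Cv order_trans[OF _ Cu[of "L y"]]) auto
    finally show ?thesis .
  qed
  then show "\<exists>C. \<forall>y. (1 + norm y) ^ k * norm (u (L y) * cnj (v (M y))) \<le> C" by blast
qed

lemma mat_wigner_fourier:
  "mat_wigner A f g (x, \<omega>)
    = fourier (\<lambda>y. f (block11 A *v x + block12 A *v y) * cnj (g (block21 A *v x + block22 A *v y))) \<omega>"
  unfolding mat_wigner_def fourier_def by (simp add: inner_commute mult.assoc)

lemma mat_wigner_integrand_regular:
  fixes A :: "real^('d::finite + 'd)^('d + 'd)" and b c :: "real^'d"
  assumes A: "invertible A" and f: "schwartz f" and g: "schwartz g"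
  defines "F \<equiv> \<lambda>y. f (b + block12 A *v y) * cnj (g (c + block22 A *v y))"
  shows "continuous_on UNIV F" and "rapidly_decreasing F"
proof -
  have "rapidly_decreasing (\<lambda>y. f (block12 A *v y - (- b)) * cnj (g (block22 A *v y - (- c))))"
    by (rule rapidly_decreasing_product_compose[where u = "\<lambda>t. f (t - (- b))" and v = "\<lambda>t. g (t - (- c))"])
       (intro rapidly_decreasing_translate schwartz_rapidly_decreasing f g
         matrix_vector_mul_linear block_column_injective[OF A])+
  then show "rapidly_decreasing F" unfolding F_def by (simp add: add.commute)
  have cont: "continuous_on UNIV (\<lambda>y. w (e + B *v y))" if "schwartz w"
    for w :: "real^'d \<Rightarrow> complex" and e and B :: "real^'d^'d"
  proof -
    have "continuous_on UNIV (\<lambda>y. e + B *v y)"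
      by (intro continuous_intros matrix_vector_mult_linear_continuous_on)
    from continuous_on_compose[OF this schwartz_continuous_on[OF that]] show ?thesis
      by (simp add: o_def)
  qed
  show "continuous_on UNIV F" unfolding F_def by (intro continuous_intros cont f g)
qed

lemma wigner_phase:
  "wigner f g (x, \<omega>) = (\<integral>y. phase (- (y \<bullet> \<omega>)) * (f (x + (1/2) *\<^sub>R y) * cnj (g (x - (1/2) *\<^sub>R y))) \<partial>lborel)"
  unfolding wigner_def phase_eq_exp by (simp add: mult.assoc)

lemma wigner_translate:
  "wigner (\<lambda>t. f (t - a)) (\<lambda>t. g (t - a)) = (\<lambda>z. wigner f g (z - (a, 0)))"
  by (rule ext) (auto simp: wigner_phase algebra_simps)

lemma wigner_modulate:
  "wigner (\<lambda>t. phase (\<xi> \<bullet> t) * f t) (\<lambda>t. phase (\<xi> \<bullet> t) * g t) = (\<lambda>z. wigner f g (z - (0, \<xi>)))"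
proof (rule ext, clarify)
  fix x \<omega>
  have "phase (- (y \<bullet> \<omega>)) * ((phase (\<xi> \<bullet> (x + (1/2) *\<^sub>R y)) * f (x + (1/2) *\<^sub>R y))
        * cnj (phase (\<xi> \<bullet> (x - (1/2) *\<^sub>R y)) * g (x - (1/2) *\<^sub>R y)))
      = phase (- (y \<bullet> (\<omega> - \<xi>))) * (f (x + (1/2) *\<^sub>R y) * cnj (g (x - (1/2) *\<^sub>R y)))" for y
  proof -
    have "- (y \<bullet> (\<omega> - \<xi>)) = - (y \<bullet> \<omega>) + (\<xi> \<bullet> (x + (1/2) *\<^sub>R y) + - (\<xi> \<bullet> (x - (1/2) *\<^sub>R y)))"
      by (simp add: inner_diff_right inner_add_right inner_commute)
    then show ?thesis by (simp only: phase_add complex_cnj_mult cnj_phase mult_ac)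
  qed
  moreover have "(x, \<omega>) - (0, \<xi>) = (x, \<omega> - \<xi>)" by simp
  ultimately show "wigner (\<lambda>t. phase (\<xi> \<bullet> t) * f t) (\<lambda>t. phase (\<xi> \<bullet> t) * g t) (x, \<omega>)
      = wigner f g ((x, \<omega>) - (0, \<xi>))"
    by (simp only: wigner_phase)
qed

text \<open>
The value of \<open>distr_conv \<Phi> \<theta>\<close> at \<open>z\<close> depends on \<open>\<Phi>\<close> only through \<open>w \<mapsto> \<Phi> (z - w)\<close>, so a shift of \<open>\<Phi>\<close> is a
shift of \<open>z\<close>.
\<close>

lemma Cohen_class_covariant:
  assumes A: "in_Cohen_class A" and sch: "schwartz f" "schwartz g" "schwartz f'" "schwartz g'"
    and w: "wigner f' g' = (\<lambda>z. wigner f g (z - w))"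
  shows "mat_wigner A f' g' z = mat_wigner A f g (z - w)"
proof -
  obtain \<theta> where "\<And>f g. schwartz f \<Longrightarrow> schwartz g \<Longrightarrow> mat_wigner A f g = distr_conv (wigner f g) \<theta>"
    using A unfolding in_Cohen_class_def by blast
  then show ?thesis using sch by (simp add: distr_conv_def w algebra_simps)
qed

lemma schwartz_phase_mult: "schwartz f \<Longrightarrow> schwartz (\<lambda>t. phase (\<xi> \<bullet> t) * f t)"
  using schwartz_modulate[of f 1 "(2 * pi) *\<^sub>R \<xi>"] by (simp add: phase_eq_exp mult_ac)

lemma gaussian_nonzero: "gaussian x \<noteq> 0"
  by (simp add: gaussian_def)

lemma cnj_gaussian: "cnj (gaussian x) = gaussian x"
  by (simp add: gaussian_def)

text \<open>
Two products of translated Gaussians agree only if their centres do: taking logarithms gives two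
quadratic polynomials in \<open>(p,q)\<close>, and their linear coefficients determine the centres.
\<close>

lemma gaussian_product_eq:
  assumes "\<And>p q. gaussian (p - a) * gaussian (q - a) = gaussian (p - \<alpha>) * gaussian (q - \<beta>)"
  shows "\<alpha> = a" "\<beta> = a"
proof -
  have e: "(p - a) \<bullet> (p - a) + (q - a) \<bullet> (q - a) = (p - \<alpha>) \<bullet> (p - \<alpha>) + (q - \<beta>) \<bullet> (q - \<beta>)" for p q
  proof -
    have "exp (- ((p - a) \<bullet> (p - a)) + - ((q - a) \<bullet> (q - a))) = exp (- ((p - \<alpha>) \<bullet> (p - \<alpha>)) + - ((q - \<beta>) \<bullet> (q - \<beta>)))"
      using assms[of p q] unfolding gaussian_def of_real_mult[symmetric] exp_add of_real_eq_iff .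
    then show ?thesis by simp
  qed
  have "p \<bullet> (\<alpha> - a) = 0" for p
    using e[of p 0] e[of 0 0] by (simp add: inner_diff_left inner_diff_right inner_commute)
  then show "\<alpha> = a" using inner_eq_zero_iff[of "\<alpha> - a"] by simp
  have "q \<bullet> (\<beta> - a) = 0" for q
    using e[of 0 q] e[of 0 0] by (simp add: inner_diff_left inner_diff_right inner_commute)
  then show "\<beta> = a" using inner_eq_zero_iff[of "\<beta> - a"] by simp
qed

lemma phase_trivial:
  fixes v :: "'a::euclidean_space"
  assumes "\<And>\<xi>. phase (\<xi> \<bullet> v) = 1"
  shows "v = 0"
proof (rule ccontr)
  assume "v \<noteq> 0"
  \<comment> \<open>Scale \<open>v\<close> so that the inner product is half a period.\<close>
  then have "phase (((1 / (2 * (v \<bullet> v))) *\<^sub>R v) \<bullet> v) = phase (1 / 2)" by simp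
  also have "\<dots> = -1" by (simp add: phase_def)
  finally show False using assms[of "(1 / (2 * (v \<bullet> v))) *\<^sub>R v"] by simp
qed

text \<open>
Covariance is tested on the Gaussian. Translation covariance compares products of Gaussians
centred at \<open>(a,a)\<close> and at \<open>(A\<^sub>1\<^sub>1 a, A\<^sub>2\<^sub>1 a)\<close>; invertibility of \<open>A\<close> makes the two arguments range over all pairs.
Modulation covariance compares the characters \<open>\<xi> \<bullet> (A\<^sub>1\<^sub>2 y - A\<^sub>2\<^sub>2 y)\<close> and \<open>\<xi> \<bullet> y\<close>.
\<close>

theorem Cohen_class_blocks:
  fixes A :: "real^('d::finite + 'd)^('d + 'd)"
  assumes A: "invertible A" and cohen: "in_Cohen_class A"
  shows "block11 A *v x = x" "block21 A *v x = x" "block22 A *v y = block12 A *v y - y"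
proof -
  let ?p = "\<lambda>x y. block11 A *v x + block12 A *v y"
  let ?q = "\<lambda>x y. block21 A *v x + block22 A *v y"
  note gs = schwartz_gaussian[where 'a = "real^'d"]
  have tr: "gaussian (p - a) * gaussian (q - a)
      = gaussian (p - block11 A *v a) * gaussian (q - block21 A *v a)" for a p q
  proof -
    obtain x y where xy: "?p x y = p" "?q x y = q" by (rule block_system_solvable[OF A])
    let ?u = "\<lambda>t. gaussian (t - a) :: complex"
    have u: "schwartz ?u" by (rule schwartz_translate[OF gs])
    have "mat_wigner A ?u ?u (x, \<omega>) = mat_wigner A gaussian gaussian (x - a, \<omega>)" for \<omega>
      using Cohen_class_covariant[OF cohen gs gs u u wigner_translate, of "(x, \<omega>)"] by simp
    then have "?u (?p x y) * cnj (?u (?q x y)) = gaussian (?p (x - a) y) * cnj (gaussian (?q (x - a) y))"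
      unfolding mat_wigner_fourier
      by (intro fourier_injective[where F = "\<lambda>y. ?u (?p x y) * cnj (?u (?q x y))"
            and G = "\<lambda>y. gaussian (?p (x - a) y) * cnj (gaussian (?q (x - a) y))"]
          mat_wigner_integrand_regular A gs u)
    moreover have "?p (x - a) y = p - block11 A *v a" "?q (x - a) y = q - block21 A *v a"
      unfolding xy[symmetric] by (simp_all add: matrix_vector_mult_diff_distrib)
    ultimately show ?thesis unfolding xy cnj_gaussian by simp
  qed
  then have b11: "block11 A *v a = a" and b21: "block21 A *v a = a" for a
    using gaussian_product_eq[OF tr] by blast+
  then show "block11 A *v x = x" "block21 A *v x = x" by blast+
  have "phase (\<xi> \<bullet> (block12 A *v y - block22 A *v y - y)) = 1" for \<xi>
  proof -
    let ?u = "\<lambda>t. phase (\<xi> \<bullet> t) * gaussian t"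
    have u: "schwartz ?u" by (rule schwartz_phase_mult[OF gs])
    \<comment> \<open>The point \<open>x = 0\<close> suffices, since \<open>x\<close> drops out of the difference of the two arguments.\<close>
    let ?g = "\<lambda>y. gaussian (?p 0 y) * cnj (gaussian (?q 0 y))"
    have "fourier (\<lambda>y. ?u (?p 0 y) * cnj (?u (?q 0 y))) \<omega> = fourier (\<lambda>y. phase (\<xi> \<bullet> y) * ?g y) \<omega>" for \<omega>
    proof -
      have "fourier (\<lambda>y. ?u (?p 0 y) * cnj (?u (?q 0 y))) \<omega> = fourier ?g (\<omega> - \<xi>)"
        using Cohen_class_covariant[OF cohen gs gs u u wigner_modulate, of "(0, \<omega>)"]
        by (simp add: mat_wigner_fourier)
      also have "\<dots> = fourier (\<lambda>y. phase (\<xi> \<bullet> y) * ?g y) \<omega>"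
      proof -
        have "phase (- (y \<bullet> (\<omega> - \<xi>))) = phase (- (y \<bullet> \<omega>)) * phase (\<xi> \<bullet> y)" for y
          unfolding phase_add[symmetric] by (simp add: inner_diff_right inner_commute)
        then show ?thesis unfolding fourier_phase by (simp only: mult.assoc)
      qed
      finally show ?thesis .
    qed
    then have "?u (?p 0 y) * cnj (?u (?q 0 y)) = phase (\<xi> \<bullet> y) * ?g y"
      by (intro fourier_injective[where F = "\<lambda>y. ?u (?p 0 y) * cnj (?u (?q 0 y))"
            and G = "\<lambda>y. phase (\<xi> \<bullet> y) * ?g y"] mat_wigner_integrand_regular A gs u
          rapidly_decreasing_mult_bounded[where B = 1] continuous_intros)
        simp_all
    then have "phase (\<xi> \<bullet> ?p 0 y) * phase (- (\<xi> \<bullet> ?q 0 y)) = phase (\<xi> \<bullet> y)"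
      by (simp add: gaussian_nonzero cnj_gaussian cnj_phase)
    then have "phase (\<xi> \<bullet> ?p 0 y + - (\<xi> \<bullet> ?q 0 y) + - (\<xi> \<bullet> y)) = 1"
      by (simp only: phase_add phase_minus_mult)
    moreover have "\<xi> \<bullet> ?p 0 y + - (\<xi> \<bullet> ?q 0 y) + - (\<xi> \<bullet> y) = \<xi> \<bullet> (block12 A *v y - block22 A *v y - y)"
      by (simp add: inner_diff_right)
    ultimately show ?thesis by simp
  qed
  from phase_trivial[OF this] show "block22 A *v y = block12 A *v y - y"
    by (simp add: algebra_simps)
qed

lemma mat_wigner_eq_tau_wigner:
  fixes A :: "real^('d::finite + 'd)^('d + 'd)"
  assumes "invertible A" "in_Cohen_class A"
  shows "mat_wigner A f g (x, \<omega>) = tau_wigner (\<lambda>y. block12 A *v y) f g x \<omega>"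
  unfolding mat_wigner_fourier tau_wigner_def twist_def[abs_def] Cohen_class_blocks[OF assms]
  by (simp add: algebra_simps)

theorem proposition4p3:
  fixes A :: "real^('d::finite + 'd)^('d + 'd)"
    and f g :: "real^'d \<Rightarrow> complex"
  assumes "invertible A"
    and "in_Cohen_class A"
    and "schwartz f" and "schwartz g"
  shows
    "((\<forall>x. has_bochner_integral lborel (\<lambda>\<omega>. mat_wigner_quad A f (x, \<omega>))
            (complex_of_real ((norm (f x))\<^sup>2))) \<and>
      (\<forall>\<omega>. has_bochner_integral lborel (\<lambda>x. mat_wigner_quad A f (x, \<omega>))
            (complex_of_real ((norm (fourier f \<omega>))\<^sup>2))) \<and>
      has_bochner_integral lborel (mat_wigner_quad A f) (complex_of_real ((L2_norm f)\<^sup>2)))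
   \<and> (integrable lborel (\<lambda>z. mat_wigner_quad A f z * cnj (mat_wigner_quad A g z)) \<and>
      L2_inner (mat_wigner_quad A f) (mat_wigner_quad A g)
        = complex_of_real ((norm (L2_inner f g))\<^sup>2))
   \<and> (\<forall>x \<omega>.
      mat_wigner_quad A (reflect f) (x, \<omega>) = mat_wigner_quad A f (- x, - \<omega>) \<and>
      mat_wigner_quad A (\<lambda>t. cnj (f t)) (x, \<omega>) = cnj (mat_wigner_quad A f (x, - \<omega>)))
   \<and> (\<forall>x \<omega>.
      integrable lborel (\<lambda>t. mat_wigner_quad A f (t, \<omega>) * mat_wigner_quad A g (x - t, \<omega>)) \<and>
      mat_wigner_quad A (conv f g) (x, \<omega>)
        = conv (\<lambda>t. mat_wigner_quad A f (t, \<omega>)) (\<lambda>t. mat_wigner_quad A g (t, \<omega>)) x \<and>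
      integrable lborel (\<lambda>\<eta>. mat_wigner_quad A f (x, \<eta>) * mat_wigner_quad A g (x, \<omega> - \<eta>)) \<and>
      mat_wigner_quad A (\<lambda>t. f t * g t) (x, \<omega>)
        = conv (\<lambda>\<eta>. mat_wigner_quad A f (x, \<eta>)) (\<lambda>\<eta>. mat_wigner_quad A g (x, \<eta>)) \<omega>)
   \<and> (\<forall>r x \<omega>. r \<noteq> 0 \<longrightarrow>
      mat_wigner_quad A (dilate r f) (x, \<omega>) = mat_wigner_quad A f (r *\<^sub>R x, inverse r *\<^sub>R \<omega>))"
proof -
  note AC = assms(1,2) and f = assms(3) and g = assms(4)
  define T where "T = (\<lambda>y. block12 A *v y)"
  have T: "linear T" unfolding T_def by (rule matrix_vector_mul_linear)
  have W: "mat_wigner A u v (x, \<omega>) = tau_wigner T u v x \<omega>" for u v x \<omega>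
    unfolding T_def by (rule mat_wigner_eq_tau_wigner[OF AC])
  then have W': "mat_wigner A u v = (\<lambda>(x, \<omega>). tau_wigner T u v x \<omega>)" for u v
    by (auto simp: fun_eq_iff)
  have WW: "(\<lambda>z. mat_wigner A f f z * cnj (mat_wigner A g g z))
      = (\<lambda>(x, \<omega>). tau_wigner T f f x \<omega> * cnj (tau_wigner T g g x \<omega>))"
    unfolding W' by (auto simp: fun_eq_iff)
  note moyal = tau_wigner_moyal[OF T f g, unfolded lborel_prod]
  show ?thesis
    unfolding W L2_inner_def[of "mat_wigner A f f"] WW
    unfolding W'
  proof (intro conjI allI impI)
    show "has_bochner_integral lborel (\<lambda>\<omega>. tau_wigner T f f x \<omega>) (complex_of_real ((norm (f x))\<^sup>2))" for x
      by (rule tau_wigner_marginal_frequency[OF T f])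
    show "has_bochner_integral lborel (\<lambda>x. tau_wigner T f f x \<omega>) (complex_of_real ((norm (fourier f \<omega>))\<^sup>2))" for \<omega>
      by (rule tau_wigner_marginal_space[OF T f])
    show "has_bochner_integral lborel (\<lambda>(x, \<omega>). tau_wigner T f f x \<omega>) (complex_of_real ((L2_norm f)\<^sup>2))"
      using tau_wigner_total[OF T f] unfolding lborel_prod .
    show "integrable lborel (\<lambda>(x, \<omega>). tau_wigner T f f x \<omega> * cnj (tau_wigner T g g x \<omega>))"
      using moyal unfolding has_bochner_integral_iff by (rule conjunct1)
    show "(\<integral>z. (case z of (x, \<omega>) \<Rightarrow> tau_wigner T f f x \<omega> * cnj (tau_wigner T g g x \<omega>)) \<partial>lborel)
        = complex_of_real ((norm (L2_inner f g))\<^sup>2)"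
      using moyal unfolding has_bochner_integral_iff by (rule conjunct2)
  next
    fix x \<omega>
    show "tau_wigner T (reflect f) (reflect f) x \<omega> = tau_wigner T f f (- x) (- \<omega>)"
      by (rule tau_wigner_reflect[OF T f])
    show "tau_wigner T (\<lambda>t. cnj (f t)) (\<lambda>t. cnj (f t)) x \<omega> = cnj (tau_wigner T f f x (- \<omega>))"
      by (rule tau_wigner_cnj)
    show "integrable lborel (\<lambda>t. tau_wigner T f f t \<omega> * tau_wigner T g g (x - t) \<omega>)"
      by (rule tau_wigner_conv(1)[OF T f g])
    show "tau_wigner T (conv f g) (conv f g) x \<omega>
        = conv (\<lambda>t. tau_wigner T f f t \<omega>) (\<lambda>t. tau_wigner T g g t \<omega>) x"
      by (rule tau_wigner_conv(2)[OF T f g])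
    show "integrable lborel (\<lambda>\<eta>. tau_wigner T f f x \<eta> * tau_wigner T g g x (\<omega> - \<eta>))"
      by (rule tau_wigner_times(1)[OF T f g])
    show "tau_wigner T (\<lambda>t. f t * g t) (\<lambda>t. f t * g t) x \<omega>
        = conv (\<lambda>\<eta>. tau_wigner T f f x \<eta>) (\<lambda>\<eta>. tau_wigner T g g x \<eta>) \<omega>"
      by (rule tau_wigner_times(2)[OF T f g])
  next
    fix r :: real and x \<omega> :: "real^'d"
    assume "r \<noteq> 0"
    then show "tau_wigner T (dilate r f) (dilate r f) x \<omega> = tau_wigner T f f (r *\<^sub>R x) (inverse r *\<^sub>R \<omega>)"
      by (rule tau_wigner_dilate[OF T f])
  qed
qed

end
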